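(* Let $k$ be an algebraically closed field of characteristic $0$ and let $K$ be a pointed Hopf algebra over $k$ with finite Gelfand-Kirillov dimension, with coradical filtration $\{K_n\}_{n\ge0}$. Let $g\ne 1$ be a group-like element of $K$, let $b$ be an integer, and let $y\in K_1\setminus K_0$ be a $(1,g^b)$-primitive element. Then there exist an integer $m\ge 0$, elements $b_0,\dots,b_m,\beta\in k$ and $\xi\in k^{\times}$ such that the element $$f=b_0y+b_1gyg^{-1}+\cdots+b_mg^myg^{-m}$$ lies in $K_1\setminus K_0$ and satisfies $gf=\xi fg+\beta g(g^b-1)$.
   Context: The coradical $K_0$ of a coalgebra $K$ is the sum of its simple subcoalgebras, and the coradical filtration is defined inductively by $K_n=\Delta^{-1}(K\otimes K_{n-1}+K_0\otimes K)$. $K$ is pointed if $K_0$ is spanned by the group-like elements. An element $y$ is $(1,g^b)$-primitive if $\Delta(y)=y\otimes 1+g^b\otimes y$. *)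

theory Defs
  imports
    "HOL-Computational_Algebra.Polynomial"
    "HOL-Library.Poly_Mapping"
    "HOL-Library.Extended_Real"
    "HOL-Library.Liminf_Limsup"
begin

text \<open>
  For a vector space \<open>V\<close> over \<open>k\<close>, the tensor products \<open>V \<otimes> V\<close> and \<open>V \<otimes> V \<otimes> V\<close> are the
  quotients of the free vector spaces on \<open>V \<times> V\<close> and \<open>V \<times> V \<times> V\<close> (finitely supported
  functions) by the subspaces spanned by the multilinearity relations.  These quotients depend
  on the scalar multiplication, which is a term, so they are not HOL types.  A tensor is
  therefore given by a representative in the free vector space, and two representatives are
  the same tensor iff they are congruent modulo the relations; every notion below that
  involves tensors is invariant under this congruence.
\<close>

definition free_scale :: "'k::field \<Rightarrow> ('x \<Rightarrow>\<^sub>0 'k) \<Rightarrow> ('x \<Rightarrow>\<^sub>0 'k)" where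
  "free_scale c p = Poly_Mapping.map ((*) c) p"

lemma lookup_free_scale [simp]:
  "Poly_Mapping.lookup (free_scale c p) x = c * Poly_Mapping.lookup p x"
  by (simp add: free_scale_def Poly_Mapping.map.rep_eq when_def)

interpretation free: vector_space "free_scale :: 'k::field \<Rightarrow> ('x \<Rightarrow>\<^sub>0 'k) \<Rightarrow> ('x \<Rightarrow>\<^sub>0 'k)"
  by unfold_locales
    (simp_all add: poly_mapping_eq_iff fun_eq_iff lookup_add algebra_simps)

text \<open>The linear extension of \<open>F\<close> from the basis of a free vector space to the whole space.\<close>

definition lin_ext :: "('k::field \<Rightarrow> 'v::ab_group_add \<Rightarrow> 'v) \<Rightarrow> ('x \<Rightarrow> 'v) \<Rightarrow> ('x \<Rightarrow>\<^sub>0 'k) \<Rightarrow> 'v" where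
  "lin_ext scale F p =
     (\<Sum>x\<in>Poly_Mapping.keys p. scale (Poly_Mapping.lookup p x) (F x))"

definition tens2 :: "'v \<Rightarrow> 'v \<Rightarrow> ('v \<times> 'v \<Rightarrow>\<^sub>0 'k::field)" where
  "tens2 x y = Poly_Mapping.single (x, y) 1"

definition tens3 :: "'v \<Rightarrow> 'v \<Rightarrow> 'v \<Rightarrow> ('v \<times> 'v \<times> 'v \<Rightarrow>\<^sub>0 'k::field)" where
  "tens3 x y z = Poly_Mapping.single (x, y, z) 1"

definition tensor2_rel ::
  "('k::field \<Rightarrow> 'v::ab_group_add \<Rightarrow> 'v) \<Rightarrow> ('v \<times> 'v \<Rightarrow>\<^sub>0 'k) set" where
  "tensor2_rel scale =
     {tens2 (x + x') y - tens2 x y - tens2 x' y | x x' y. True} \<union>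
     {tens2 x (y + y') - tens2 x y - tens2 x y' | x y y'. True} \<union>
     {tens2 (scale c x) y - free_scale c (tens2 x y) | c x y. True} \<union>
     {tens2 x (scale c y) - free_scale c (tens2 x y) | c x y. True}"

definition tensor3_rel ::
  "('k::field \<Rightarrow> 'v::ab_group_add \<Rightarrow> 'v) \<Rightarrow> ('v \<times> 'v \<times> 'v \<Rightarrow>\<^sub>0 'k) set" where
  "tensor3_rel scale =
     {tens3 (x + x') y z - tens3 x y z - tens3 x' y z | x x' y z. True} \<union>
     {tens3 x (y + y') z - tens3 x y z - tens3 x y' z | x y y' z. True} \<union>
     {tens3 x y (z + z') - tens3 x y z - tens3 x y z' | x y z z'. True} \<union>
     {tens3 (scale c x) y z - free_scale c (tens3 x y z) | c x y z. True} \<union>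
     {tens3 x (scale c y) z - free_scale c (tens3 x y z) | c x y z. True} \<union>
     {tens3 x y (scale c z) - free_scale c (tens3 x y z) | c x y z. True}"

definition tensor2_eq ::
  "('k::field \<Rightarrow> 'v::ab_group_add \<Rightarrow> 'v) \<Rightarrow> ('v \<times> 'v \<Rightarrow>\<^sub>0 'k) \<Rightarrow> ('v \<times> 'v \<Rightarrow>\<^sub>0 'k) \<Rightarrow> bool" where
  "tensor2_eq scale p q \<longleftrightarrow> p - q \<in> free.span (tensor2_rel scale)"

definition tensor3_eq ::
  "('k::field \<Rightarrow> 'v::ab_group_add \<Rightarrow> 'v) \<Rightarrow>
   ('v \<times> 'v \<times> 'v \<Rightarrow>\<^sub>0 'k) \<Rightarrow> ('v \<times> 'v \<times> 'v \<Rightarrow>\<^sub>0 'k) \<Rightarrow> bool" where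
  "tensor3_eq scale p q \<longleftrightarrow> p - q \<in> free.span (tensor3_rel scale)"

text \<open>The representatives of the tensors in (the image of) \<open>U \<otimes> W \<subseteq> V \<otimes> V\<close>.\<close>

definition tensor2_sub ::
  "('k::field \<Rightarrow> 'v::ab_group_add \<Rightarrow> 'v) \<Rightarrow> 'v set \<Rightarrow> 'v set \<Rightarrow> ('v \<times> 'v \<Rightarrow>\<^sub>0 'k) set" where
  "tensor2_sub scale U W =
     {p. \<exists>q \<in> free.span {tens2 u w | u w. u \<in> U \<and> w \<in> W}. tensor2_eq scale p q}"

text \<open>The product \<open>(a \<otimes> b)(c \<otimes> d) = ac \<otimes> bd\<close> of \<open>A \<otimes> A\<close>.\<close>

definition tensor2_mult ::
  "('a::times \<times> 'a \<Rightarrow>\<^sub>0 'k::field) \<Rightarrow> ('a \<times> 'a \<Rightarrow>\<^sub>0 'k) \<Rightarrow> ('a \<times> 'a \<Rightarrow>\<^sub>0 'k)" where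
  "tensor2_mult p q =
     lin_ext free_scale
       (\<lambda>(a, b). lin_ext free_scale (\<lambda>(c, d). tens2 (a * c) (b * d)) q) p"

text \<open>The maps \<open>D \<otimes> id\<close> and \<open>id \<otimes> D\<close> from \<open>V \<otimes> V\<close> to \<open>V \<otimes> V \<otimes> V\<close> for \<open>D : V \<rightarrow> V \<otimes> V\<close>.\<close>

definition tensor_map_left ::
  "('v \<Rightarrow> ('v \<times> 'v \<Rightarrow>\<^sub>0 'k::field)) \<Rightarrow> ('v \<times> 'v \<Rightarrow>\<^sub>0 'k) \<Rightarrow> ('v \<times> 'v \<times> 'v \<Rightarrow>\<^sub>0 'k)" where
  "tensor_map_left D =
     lin_ext free_scale (\<lambda>(x, y). lin_ext free_scale (\<lambda>(u, v). tens3 u v y) (D x))"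

definition tensor_map_right ::
  "('v \<Rightarrow> ('v \<times> 'v \<Rightarrow>\<^sub>0 'k::field)) \<Rightarrow> ('v \<times> 'v \<Rightarrow>\<^sub>0 'k) \<Rightarrow> ('v \<times> 'v \<times> 'v \<Rightarrow>\<^sub>0 'k)" where
  "tensor_map_right D =
     lin_ext free_scale (\<lambda>(x, y). lin_ext free_scale (\<lambda>(u, v). tens3 x u v) (D y))"

locale coalgebra = vector_space scale
  for scale :: "'k::field \<Rightarrow> 'a::ab_group_add \<Rightarrow> 'a" +
  fixes comult :: "'a \<Rightarrow> ('a \<times> 'a \<Rightarrow>\<^sub>0 'k)"
    and counit :: "'a \<Rightarrow> 'k"
  assumes comult_add: "tensor2_eq scale (comult (x + y)) (comult x + comult y)"
    and comult_scale: "tensor2_eq scale (comult (scale c x)) (free_scale c (comult x))"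
    and counit_add: "counit (x + y) = counit x + counit y"
    and counit_scale: "counit (scale c x) = c * counit x"
    and coassoc: "tensor3_eq scale (tensor_map_left comult (comult x))
                                   (tensor_map_right comult (comult x))"
    and counit_left: "lin_ext scale (\<lambda>(u, v). scale (counit u) v) (comult x) = x"
    and counit_right: "lin_ext scale (\<lambda>(u, v). scale (counit v) u) (comult x) = x"
begin

definition subcoalgebra :: "'a set \<Rightarrow> bool" where
  "subcoalgebra D \<longleftrightarrow> subspace D \<and> (\<forall>x\<in>D. comult x \<in> tensor2_sub scale D D)"

definition simple_subcoalgebra :: "'a set \<Rightarrow> bool" where
  "simple_subcoalgebra D \<longleftrightarrow>
     subcoalgebra D \<and> D \<noteq> {0} \<and> (\<forall>E. subcoalgebra E \<and> E \<subseteq> D \<longrightarrow> E = {0} \<or> E = D)"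

definition coradical :: "'a set" where
  "coradical = span (\<Union> {D. simple_subcoalgebra D})"

fun coradical_filtration :: "nat \<Rightarrow> 'a set" where
  "coradical_filtration 0 = coradical"
| "coradical_filtration (Suc n) =
     {x. \<exists>p \<in> tensor2_sub scale UNIV (coradical_filtration n).
         \<exists>q \<in> tensor2_sub scale coradical UNIV. tensor2_eq scale (comult x) (p + q)}"

definition grouplike :: "'a \<Rightarrow> bool" where
  "grouplike g \<longleftrightarrow> tensor2_eq scale (comult g) (tens2 g g) \<and> counit g = 1"

definition pointed :: bool where
  "pointed \<longleftrightarrow> coradical = span {g. grouplike g}"

end

locale algebra_over = vector_space scale
  for scale :: "'k::field \<Rightarrow> 'a::ring_1 \<Rightarrow> 'a" +
  assumes scale_mult_left: "scale c x * y = scale c (x * y)"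
    and scale_mult_right: "x * scale c y = scale c (x * y)"
begin

text \<open>\<open>k + V + V\<^sup>2 + \<dots> + V\<^sup>n\<close>; the empty product contributes \<open>k\<close>.\<close>

definition power_sum :: "'a set \<Rightarrow> nat \<Rightarrow> 'a set" where
  "power_sum V n = span {prod_list xs | xs. set xs \<subseteq> V \<and> length xs \<le> n}"

text \<open>\<open>sup\<^sub>V limsup\<^sub>n log\<^sub>n dim (k + V + \<dots> + V\<^sup>n)\<close>, over the finite-dimensional subspaces \<open>V\<close>.\<close>

definition GK_dim :: ereal where
  "GK_dim = (SUP V \<in> {span B | B. finite B}.
     limsup (\<lambda>n. ereal (log (real n) (real (dim (power_sum V n))))))"

end

locale hopf_algebra = algebra_over scale + coalgebra scale comult counit
  for scale :: "'k::field \<Rightarrow> 'a::ring_1 \<Rightarrow> 'a"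
    and comult :: "'a \<Rightarrow> ('a \<times> 'a \<Rightarrow>\<^sub>0 'k)"
    and counit :: "'a \<Rightarrow> 'k" +
  fixes antipode :: "'a \<Rightarrow> 'a"
  assumes comult_one: "tensor2_eq scale (comult 1) (tens2 1 1)"
    and comult_mult: "tensor2_eq scale (comult (x * y)) (tensor2_mult (comult x) (comult y))"
    and counit_one: "counit 1 = 1"
    and counit_mult: "counit (x * y) = counit x * counit y"
    and antipode_add: "antipode (x + y) = antipode x + antipode y"
    and antipode_scale: "antipode (scale c x) = scale c (antipode x)"
    and antipode_left:
      "lin_ext scale (\<lambda>(u, v). antipode u * v) (comult x) = scale (counit x) 1"
    and antipode_right:
      "lin_ext scale (\<lambda>(u, v). u * antipode v) (comult x) = scale (counit x) 1"

text \<open>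
  Inverses and integer powers of units in a noncommutative ring; \<open>unit_inv x\<close> is unspecified
  if \<open>x\<close> is not a unit.  Group-like elements of a Hopf algebra are units.
\<close>

definition unit_inv :: "'a::monoid_mult \<Rightarrow> 'a" where
  "unit_inv x = (THE y. x * y = 1 \<and> y * x = 1)"

definition unit_power :: "'a::monoid_mult \<Rightarrow> int \<Rightarrow> 'a" where
  "unit_power x b = (if b \<ge> 0 then x ^ nat b else unit_inv x ^ nat (- b))"

text \<open>\<open>(g, h)\<close>-primitive elements in the convention \<open>\<Delta>(y) = y \<otimes> g + h \<otimes> y\<close>.\<close>

definition (in coalgebra) skew_primitive :: "'a \<Rightarrow> 'a \<Rightarrow> 'a \<Rightarrow> bool" where
  "skew_primitive g h y \<longleftrightarrow> tensor2_eq scale (comult y) (tens2 y g + tens2 h y)"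

end

theory Submission
  imports Defs "HOL-Real_Asymp.Real_Asymp"
begin

text \<open>
  Let \<open>T\<close> be conjugation by \<open>g\<close>, \<open>h = g\<^sup>b\<close> and \<open>y\<^sub>i = T\<^sup>i y\<close>; all \<open>y\<^sub>i\<close> are \<open>(1, h)\<close>-primitive.
  If \<open>p(T) y\<close> lies in \<open>K\<^sub>0\<close> for some polynomial \<open>p \<noteq> 0\<close>, take \<open>p\<close> of minimal degree, a root
  \<open>\<xi>\<close> of \<open>p = (t - \<xi>) q\<close>, and \<open>f = q(T) y\<close>: then \<open>T f - \<xi> f\<close> is skew primitive and lies in the
  span of the group-likes, hence is a multiple of \<open>h - 1\<close>.
  Otherwise \<open>y\<^sub>0, y\<^sub>1, \<dots>\<close> are linearly independent modulo \<open>K\<^sub>0\<close>, and then the \<open>2\<^sup>N\<close> products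
  \<open>y\<^bsub>i\<^sub>1\<^esub> \<dots> y\<^bsub>i\<^sub>r\<^esub>\<close> with \<open>i\<^sub>1 < \<dots> < i\<^sub>r < N\<close> are linearly independent: a functional \<open>d\<close> that kills
  the group-likes and all \<open>y\<^sub>i\<close> with \<open>i < N\<close>, but not \<open>y\<^sub>N\<close>, gives a map \<open>(id \<otimes> d) \<circ> \<Delta>\<close> that
  lowers the word length by one, and up to shorter words it kills the words in \<open>y\<^sub>0, \<dots>, y\<^bsub>N-1\<^esub>\<close>
  and sends \<open>w y\<^sub>N\<close> to \<open>w h\<close>.
  Since \<open>y\<^bsub>i\<^sub>1\<^esub> \<dots> y\<^bsub>i\<^sub>r\<^esub> g\<^sup>N\<close> telescopes to a word of length at most \<open>2 N\<close> in \<open>g\<close> and \<open>y\<close>, the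
  growth would be exponential, contradicting finite Gelfand-Kirillov dimension.
\<close>

section \<open>Tensors and linear extensions\<close>

context vector_space
begin

lemma lin_ext_superset:
  assumes "finite A" "Poly_Mapping.keys p \<subseteq> A"
  shows "lin_ext scale F p = (\<Sum>x\<in>A. scale (Poly_Mapping.lookup p x) (F x))"
  unfolding lin_ext_def using assms
  by (intro sum.mono_neutral_left) (auto simp: in_keys_iff)

lemma lin_ext_add: "lin_ext scale F (p + q) = lin_ext scale F p + lin_ext scale F q"
proof -
  let ?A = "Poly_Mapping.keys p \<union> Poly_Mapping.keys q"
  have "lin_ext scale F r = (\<Sum>x\<in>?A. scale (Poly_Mapping.lookup r x) (F x))"
    if "r \<in> {p, q, p + q}" for r
    using that keys_add[of p q] by (intro lin_ext_superset) auto
  then show ?thesis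
    by (simp add: lookup_add scale_left_distrib sum.distrib)
qed

lemma lin_ext_scale: "lin_ext scale F (free_scale c p) = scale c (lin_ext scale F p)"
proof -
  have "Poly_Mapping.keys (free_scale c p) \<subseteq> Poly_Mapping.keys p"
    by (auto simp: in_keys_iff)
  then show ?thesis
    by (simp add: lin_ext_superset[of "Poly_Mapping.keys p"] scale_sum_right)
qed

lemma lin_ext_zero: "lin_ext scale F 0 = 0"
  by (simp add: lin_ext_def)

lemma lin_ext_diff: "lin_ext scale F (p - q) = lin_ext scale F p - lin_ext scale F q"
  using lin_ext_add[of F "p - q" q] by (simp add: algebra_simps)

lemma lin_ext_tens2 [simp]: "lin_ext scale F (tens2 a b) = F (a, b)"
  by (simp add: lin_ext_def tens2_def)

lemma lin_ext_cong:
  assumes "\<And>a b. F (a, b) = G (a, b)"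
  shows "lin_ext scale F p = lin_ext scale G p"
  unfolding lin_ext_def using assms by (intro sum.cong) auto

lemma linear_comp_lin_ext:
  assumes "\<And>p q. L (p + q) = L p + L q" "\<And>c p. L (s c p) = scale c (L p)"
    and "vector_space s"
  shows "L (lin_ext s F p) = lin_ext scale (\<lambda>x. L (F x)) p"
proof -
  have "L 0 = 0"
    using assms(1)[of 0 0] by simp
  then have "L (sum f A) = (\<Sum>x\<in>A. L (f x))" for f :: "'d \<Rightarrow> 'c" and A
    by (induction A rule: infinite_finite_induct) (simp_all add: assms(1))
  then show ?thesis
    by (simp add: lin_ext_def assms(2))
qed

lemma lin_ext_fun_add:
  "lin_ext scale (\<lambda>(a, b). F a b + G a b) p
     = lin_ext scale (\<lambda>(a, b). F a b) p + lin_ext scale (\<lambda>(a, b). G a b) p"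
  by (simp add: lin_ext_def case_prod_unfold scale_right_distrib sum.distrib)

lemma lin_ext_fun_scale:
  "lin_ext scale (\<lambda>(a, b). scale c (F a b)) p = scale c (lin_ext scale (\<lambda>(a, b). F a b) p)"
  by (simp add: lin_ext_def case_prod_unfold scale_sum_right mult.commute)

lemma lin_ext_swap:
  "lin_ext scale (\<lambda>x. lin_ext scale (\<lambda>z. F x z) q) p
     = lin_ext scale (\<lambda>z. lin_ext scale (\<lambda>x. F x z) p) q"
  unfolding lin_ext_def scale_sum_right
  by (subst sum.swap) (simp add: mult.commute)

text \<open>The universal property of \<open>V \<otimes> V\<close>: the kernel of the linear
  extension of a bilinear \<open>f\<close> is a subspace that contains every relation, hence their
  span. Evaluation may thus use any representative of a tensor.\<close>

lemma lin_ext_tensor2_eq: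
  assumes "tensor2_eq scale p q"
    and "\<And>x x' y. f (x + x') y = f x y + f x' y" "\<And>x y y'. f x (y + y') = f x y + f x y'"
    and "\<And>c x y. f (scale c x) y = scale c (f x y)" "\<And>c x y. f x (scale c y) = scale c (f x y)"
  shows "lin_ext scale (\<lambda>(x, y). f x y) p = lin_ext scale (\<lambda>(x, y). f x y) q"
proof -
  have "p - q \<in> free.span (tensor2_rel scale)"
    using assms(1) by (simp add: tensor2_eq_def)
  moreover have "free.subspace {r. lin_ext scale (\<lambda>(x, y). f x y) r = 0}"
    by (simp add: free.subspace_def lin_ext_add lin_ext_scale lin_ext_zero)
  moreover have "tensor2_rel scale \<subseteq> {r. lin_ext scale (\<lambda>(x, y). f x y) r = 0}"
    by (auto simp: tensor2_rel_def lin_ext_diff lin_ext_scale assms)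
  ultimately have "lin_ext scale (\<lambda>(x, y). f x y) (p - q) = 0"
    using free.span_minimal by blast
  then show ?thesis
    by (simp add: lin_ext_diff)
qed

lemma tensor2_eq_refl: "tensor2_eq scale p p"
  by (simp add: tensor2_eq_def free.span_zero)

lemma tensor2_eq_sym: "tensor2_eq scale p q \<Longrightarrow> tensor2_eq scale q p"
  using free.span_neg by (fastforce simp: tensor2_eq_def)

lemma tensor2_eq_trans [trans]:
  "tensor2_eq scale p q \<Longrightarrow> tensor2_eq scale q r \<Longrightarrow> tensor2_eq scale p r"
  using free.span_add by (fastforce simp: tensor2_eq_def)

lemma tensor2_eq_add:
  "tensor2_eq scale p q \<Longrightarrow> tensor2_eq scale p' q' \<Longrightarrow> tensor2_eq scale (p + p') (q + q')"
  unfolding tensor2_eq_def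
  by (metis free.span_add add_diff_add)

lemma tensor2_eq_scale:
  "tensor2_eq scale p q \<Longrightarrow> tensor2_eq scale (free_scale c p) (free_scale c q)"
  unfolding tensor2_eq_def
  by (metis free.span_scale free.scale_right_diff_distrib)

lemma tensor2_eq_add_left: "tensor2_eq scale (tens2 (x + x') y) (tens2 x y + tens2 x' y)"
  unfolding tensor2_eq_def tensor2_rel_def diff_diff_eq[symmetric] by (rule free.span_base) blast

lemma tensor2_eq_add_right: "tensor2_eq scale (tens2 x (y + y')) (tens2 x y + tens2 x y')"
  unfolding tensor2_eq_def tensor2_rel_def diff_diff_eq[symmetric] by (rule free.span_base) blast

lemma tensor2_eq_scale_left: "tensor2_eq scale (tens2 (scale c x) y) (free_scale c (tens2 x y))"
  unfolding tensor2_eq_def tensor2_rel_def by (rule free.span_base) blast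

lemma tensor2_eq_scale_right: "tensor2_eq scale (tens2 x (scale c y)) (free_scale c (tens2 x y))"
  unfolding tensor2_eq_def tensor2_rel_def by (rule free.span_base) blast

lemma tensor2_sub_tens2: "u \<in> U \<Longrightarrow> w \<in> W \<Longrightarrow> tens2 u w \<in> tensor2_sub scale U W"
  by (auto simp: tensor2_sub_def intro!: bexI[of _ "tens2 u w"] tensor2_eq_refl free.span_base)

text \<open>Well-definedness of \<open>f \<otimes> h\<close>: by linearity of both maps, each
  relation is sent to a relation.\<close>

lemma tensor2_eq_map:
  assumes "\<And>x y. f (x + y) = f x + f y" "\<And>c x. f (scale c x) = scale c (f x)"
    and "\<And>x y. h (x + y) = h x + h y" "\<And>c x. h (scale c x) = scale c (h x)"
    and "tensor2_eq scale p q"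
  shows "tensor2_eq scale (lin_ext free_scale (\<lambda>(x, y). tens2 (f x) (h y)) p)
           (lin_ext free_scale (\<lambda>(x, y). tens2 (f x) (h y)) q)"
proof -
  let ?L = "lin_ext free_scale (\<lambda>(x, y). tens2 (f x) (h y) :: 'b \<times> 'b \<Rightarrow>\<^sub>0 'a)"
  define R where "R = free.span (tensor2_rel scale)"
  have rel: "tensor2_eq scale u v \<longleftrightarrow> u - v \<in> R" for u v
    by (simp add: tensor2_eq_def R_def)
  have "free.subspace {r. ?L r \<in> R}"
    by (auto simp: free.subspace_def free.lin_ext_add free.lin_ext_scale free.lin_ext_zero R_def
        intro: free.span_add free.span_scale free.span_zero)
  moreover have "tensor2_rel scale \<subseteq> {r. ?L r \<in> R}"
    using tensor2_eq_add_left tensor2_eq_add_right tensor2_eq_scale_left tensor2_eq_scale_right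
    by (auto simp: tensor2_rel_def rel free.lin_ext_diff free.lin_ext_add free.lin_ext_tens2
        free.lin_ext_scale assms(1-4) diff_diff_eq)
  ultimately have "free.span (tensor2_rel scale) \<subseteq> {r. ?L r \<in> R}"
    by (rule free.span_minimal[rotated])
  then show ?thesis
    using assms(5) by (auto simp: rel free.lin_ext_diff) (auto simp: R_def free.lin_ext_diff)
qed

end

section \<open>The product on tensors respects the tensor relations\<close>

context algebra_over
begin

lemma tensor2_mult_add_left: "tensor2_mult (p + p') q = tensor2_mult p q + tensor2_mult p' q"
  by (simp add: tensor2_mult_def free.lin_ext_add)

lemma tensor2_mult_add_right: "tensor2_mult p (q + q') = tensor2_mult p q + tensor2_mult p q'"
  by (simp add: tensor2_mult_def free.lin_ext_add free.lin_ext_fun_add)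

lemma tensor2_mult_tens2 [simp]:
  "tensor2_mult (tens2 a b) (tens2 c d) = (tens2 (a * c) (b * d) :: 'a \<times> 'a \<Rightarrow>\<^sub>0 'k)"
  by (simp add: tensor2_mult_def)

lemma tensor2_mult_cong_right:
  assumes "tensor2_eq scale q q'"
  shows "tensor2_eq scale (tensor2_mult p q) (tensor2_mult p q')"
proof -
  have "lin_ext free_scale (\<lambda>(c, d). tens2 (a * c) (b * d)) q
      - lin_ext free_scale (\<lambda>(c, d). tens2 (a * c) (b * d)) q' \<in> free.span (tensor2_rel scale)" for a b
    using tensor2_eq_map[of "(*) a" "(*) b", OF _ _ _ _ assms]
    by (simp add: tensor2_eq_def distrib_left scale_mult_right)
  then show ?thesis
    unfolding tensor2_mult_def tensor2_eq_def lin_ext_def[of _ _ p]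
      sum_subtractf[symmetric] free.scale_right_diff_distrib[symmetric]
    by (auto intro!: free.span_sum free.span_scale)
qed

lemma tensor2_mult_cong_left:
  assumes "tensor2_eq scale p p'"
  shows "tensor2_eq scale (tensor2_mult p q) (tensor2_mult p' q)"
proof -
  \<comment> \<open>Exchanging the two sums puts the left argument innermost, so that for fixed
    \<open>c\<close> and \<open>d\<close> only right multiplication by \<open>c \<otimes> d\<close>
    remains, to which \<open>tensor2_eq_map\<close> applies.\<close>
  have swap: "tensor2_mult r q
      = lin_ext free_scale (\<lambda>(c, d). lin_ext free_scale (\<lambda>(a, b). tens2 (a * c) (b * d)) r) q"
    for r :: "'a \<times> 'a \<Rightarrow>\<^sub>0 'k"
    unfolding tensor2_mult_def case_prod_unfold by (rule free.lin_ext_swap)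
  have "lin_ext free_scale (\<lambda>(a, b). tens2 (a * c) (b * d)) p
      - lin_ext free_scale (\<lambda>(a, b). tens2 (a * c) (b * d)) p' \<in> free.span (tensor2_rel scale)" for c d
    using tensor2_eq_map[of "\<lambda>a. a * c" "\<lambda>b. b * d", OF _ _ _ _ assms]
    by (simp add: tensor2_eq_def distrib_right scale_mult_left)
  then show ?thesis
    unfolding swap tensor2_eq_def lin_ext_def[of _ _ q]
      sum_subtractf[symmetric] free.scale_right_diff_distrib[symmetric]
    by (auto intro!: free.span_sum free.span_scale)
qed

lemma lin_ext_tensor2_mult:
  fixes f :: "'a \<Rightarrow> 'a \<Rightarrow> 'a"
  shows
  "lin_ext scale (\<lambda>(x, y). f x y) (tensor2_mult p q)
     = lin_ext scale (\<lambda>(a, b). lin_ext scale (\<lambda>(c, d). f (a * c) (b * d)) q) p"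
proof -
  have *: "lin_ext scale (\<lambda>(x, y). f x y) (lin_ext free_scale F r)
      = lin_ext scale (\<lambda>x. lin_ext scale (\<lambda>(x, y). f x y) (F x)) r"
      for F and r :: "'a \<times> 'a \<Rightarrow>\<^sub>0 'k"
    by (rule linear_comp_lin_ext) (auto simp: lin_ext_add lin_ext_scale free.vector_space_axioms)
  show ?thesis
    unfolding tensor2_mult_def * by (rule lin_ext_cong) (auto simp: * intro!: lin_ext_cong)
qed

end

section \<open>Functionals, group-likes and skew primitives\<close>

definition linear_functional :: "('k::field \<Rightarrow> 'v::ab_group_add \<Rightarrow> 'v) \<Rightarrow> ('v \<Rightarrow> 'k) \<Rightarrow> bool" where
  "linear_functional scale d \<longleftrightarrow> (\<forall>x y. d (x + y) = d x + d y) \<and> (\<forall>c x. d (scale c x) = c * d x)"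

context vector_space
begin

lemma linear_functional_zero: "linear_functional scale d \<Longrightarrow> d 0 = 0"
  unfolding linear_functional_def by (metis mult_zero_left scale_zero_left)

text \<open>\<open>d\<close> is the coordinate of \<open>x\<close> relative to a basis of
  \<open>span S\<close> enlarged by \<open>x\<close>, extended linearly to the whole space.\<close>

lemma separating_functional:
  assumes "x \<notin> span S"
  obtains d where "linear_functional scale d" "\<And>s. s \<in> S \<Longrightarrow> d s = 0" "d x = 1"
proof -
  interpret field: vector_space "(*) :: 'a \<Rightarrow> 'a \<Rightarrow> 'a"
    by unfold_locales (simp_all add: algebra_simps)
  interpret vector_space_pair scale "(*) :: 'a \<Rightarrow> 'a \<Rightarrow> 'a" ..
  obtain B where B: "B \<subseteq> S" "independent B" "S \<subseteq> span B"
    using maximal_independent_subset by blast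
  then have "x \<notin> span B"
    using assms span_mono by blast
  with B have ind: "independent (insert x B)"
    by (simp add: independent_insertI)
  define d where "d = construct (insert x B) (\<lambda>b. if b = x then 1 else 0)"
  have lin: "Vector_Spaces.linear scale (*) d"
    unfolding d_def by (rule linear_construct[OF ind])
  have zero: "d b = 0" if "b \<in> B" for b
    using that construct_basis[OF ind, of b] \<open>x \<notin> span B\<close> span_base unfolding d_def by auto
  have "d s = 0" if "s \<in> S" for s
    using linear_eq_0_on_span[OF lin zero, of B] that B(3) by blast
  moreover have "d x = 1"
    using construct_basis[OF ind, of x] unfolding d_def by simp
  moreover have "linear_functional scale d"
    using linear_add[OF lin] linear_scale[OF lin] by (simp add: linear_functional_def)
  ultimately show ?thesis
    using that by blast
qed

end

section \<open>Contraction of the coproduct with a functional\<close>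

context coalgebra
begin

text \<open>The map \<open>(id \<otimes> d) \<circ> \<Delta>\<close>, that is, the action of the
  dual algebra on the coalgebra. For linear \<open>d\<close> it turns congruences between tensors
  into equations in the coalgebra itself.\<close>

definition contract :: "('a \<Rightarrow> 'k) \<Rightarrow> 'a \<Rightarrow> 'a" where
  "contract d x = lin_ext scale (\<lambda>(u, v). scale (d v) u) (comult x)"

lemma contract_eq:
  assumes "linear_functional scale d" "tensor2_eq scale (comult x) p"
  shows "contract d x = lin_ext scale (\<lambda>(u, v). scale (d v) u) p"
  unfolding contract_def
  using assms(1) by (intro lin_ext_tensor2_eq[OF assms(2)])
    (simp_all add: linear_functional_def scale_right_distrib scale_left_distrib mult.commute)

lemma contract_add: "linear_functional scale d \<Longrightarrow> contract d (x + y) = contract d x + contract d y"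
  by (simp add: contract_eq[OF _ comult_add] lin_ext_add) (simp add: contract_def)

lemma contract_scale: "linear_functional scale d \<Longrightarrow> contract d (scale c x) = scale c (contract d x)"
  by (simp add: contract_eq[OF _ comult_scale] lin_ext_scale) (simp add: contract_def)

lemma contract_zero: "linear_functional scale d \<Longrightarrow> contract d 0 = 0"
  using contract_scale[of d 0 0] by simp

lemma contract_sum: "linear_functional scale d \<Longrightarrow> contract d (sum f A) = (\<Sum>a\<in>A. contract d (f a))"
  by (induction A rule: infinite_finite_induct) (simp_all add: contract_zero contract_add)

lemma contract_mem_span:
  assumes "linear_functional scale d" "\<And>z. z \<in> S \<Longrightarrow> contract d z \<in> span T" "x \<in> span S"
  shows "contract d x \<in> span T"
  using assms(3)
  by (induction rule: span_induct_alt)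
    (auto simp: assms contract_zero contract_add contract_scale span_zero intro!: span_add span_scale)

lemma contract_functional_add:
  "contract (\<lambda>v. d v + e v) x = contract d x + contract e x"
  by (simp add: contract_def scale_left_distrib lin_ext_fun_add)

lemma contract_counit: "contract counit x = x"
  by (simp add: contract_def counit_right)

lemma linear_functional_counit: "linear_functional scale counit"
  by (simp add: linear_functional_def counit_add counit_scale)

lemma contract_grouplike:
  "linear_functional scale d \<Longrightarrow> grouplike \<gamma> \<Longrightarrow> contract d \<gamma> = scale (d \<gamma>) \<gamma>"
  by (auto simp: grouplike_def contract_eq)

lemma contract_skew_primitive:
  "linear_functional scale d \<Longrightarrow> skew_primitive u h y \<Longrightarrow> contract d y = scale (d u) y + scale (d y) h"
  by (simp add: contract_eq skew_primitive_def lin_ext_add)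

lemma comult_zero: "tensor2_eq scale (comult 0) 0"
  using comult_scale[of 0 0] by simp

lemma subspace_skew_primitive: "subspace {y. skew_primitive u h y}"
proof (rule subspaceI; unfold mem_Collect_eq skew_primitive_def)
  show "tensor2_eq scale (comult 0) (tens2 0 u + tens2 h 0)"
  proof -
    \<comment> \<open>A basis symbol such as \<open>tens2 0 u\<close> is nonzero in the free space;
      it vanishes only modulo the relations, by pulling out the scalar 0.\<close>
    have "tensor2_eq scale 0 (tens2 0 u + tens2 h 0)"
      using tensor2_eq_add[OF tensor2_eq_scale_left[of 0 0 u] tensor2_eq_scale_right[of h 0 0]]
      by (simp add: tensor2_eq_sym)
    then show ?thesis
      using comult_zero tensor2_eq_trans by blast
  qed
next
  fix x y
  assume x: "tensor2_eq scale (comult x) (tens2 x u + tens2 h x)"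
    and y: "tensor2_eq scale (comult y) (tens2 y u + tens2 h y)"
  note comult_add
  also note tensor2_eq_add[OF x y]
  also have "tens2 x u + tens2 h x + (tens2 y u + tens2 h y :: 'a \<times> 'a \<Rightarrow>\<^sub>0 'k)
      = tens2 x u + tens2 y u + (tens2 h x + tens2 h y)"
    by (simp add: algebra_simps)
  also have "tensor2_eq scale \<dots> (tens2 (x + y) u + tens2 h (x + y))"
    by (intro tensor2_eq_add tensor2_eq_sym[OF tensor2_eq_add_left]
        tensor2_eq_sym[OF tensor2_eq_add_right])
  finally show "tensor2_eq scale (comult (x + y)) (tens2 (x + y) u + tens2 h (x + y))" .
next
  fix c x
  assume x: "tensor2_eq scale (comult x) (tens2 x u + tens2 h x)"
  note comult_scale
  also note tensor2_eq_scale[OF x]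
  also have "free_scale c (tens2 x u + tens2 h x :: 'a \<times> 'a \<Rightarrow>\<^sub>0 'k) = free_scale c (tens2 x u) + free_scale c (tens2 h x)"
    by (rule free.scale_right_distrib)
  also have "tensor2_eq scale \<dots> (tens2 (scale c x) u + tens2 h (scale c x))"
    by (intro tensor2_eq_add tensor2_eq_sym[OF tensor2_eq_scale_left]
        tensor2_eq_sym[OF tensor2_eq_scale_right])
  finally show "tensor2_eq scale (comult (scale c x)) (tens2 (scale c x) u + tens2 h (scale c x))" .
qed

text \<open>Of the two summands of the coproduct, \<open>y \<otimes> u\<close> lies in
  \<open>K \<otimes> K\<^sub>0\<close> and \<open>h \<otimes> y\<close> in
  \<open>K\<^sub>0 \<otimes> K\<close>.\<close>

lemma skew_primitive_in_filtration_1: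
  assumes "skew_primitive u h y" "u \<in> coradical" "h \<in> coradical"
  shows "y \<in> coradical_filtration 1"
  using assms unfolding skew_primitive_def One_nat_def coradical_filtration.simps mem_Collect_eq
  by (intro bexI[of _ "tens2 y u"] bexI[of _ "tens2 h y"]) (auto intro: tensor2_sub_tens2)

lemma grouplike_nonzero: "grouplike \<gamma> \<Longrightarrow> \<gamma> \<noteq> 0"
  using linear_functional_zero[OF linear_functional_counit] by (auto simp: grouplike_def)

text \<open>For the functional dual to \<open>a\<close> within \<open>B\<close>, evaluation and
  contraction both isolate the coefficient of \<open>a\<close>: the first as a scalar, the second as
  a multiple of \<open>a\<close>.\<close>

lemma grouplike_coefficient:
  assumes "independent B" "B \<subseteq> {\<gamma>. grouplike \<gamma>}" "finite t" "t \<subseteq> B" "a \<in> t"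
  obtains d where "linear_functional scale d" "\<And>s. s \<in> B - {a} \<Longrightarrow> d s = 0" "d a = 1"
    "d (\<Sum>s\<in>t. scale (r s) s) = r a"
    "contract d (\<Sum>s\<in>t. scale (r s) s) = scale (r a) a"
proof -
  have "a \<notin> span (B - {a})"
    using assms by (auto simp: dependent_def)
  then obtain d where d: "linear_functional scale d" "\<And>s. s \<in> B - {a} \<Longrightarrow> d s = 0" "d a = 1"
    by (rule separating_functional) blast
  have "d (sum f A) = (\<Sum>x\<in>A. d (f x))" for f :: "'a \<Rightarrow> 'a" and A
    using d(1) linear_functional_zero[OF d(1)]
    by (induction A rule: infinite_finite_induct) (simp_all add: linear_functional_def)
  moreover have d_eq: "d (scale (r s) s) = (if s = a then r a else 0)" if "s \<in> t" for s
    using d assms(4) that by (auto simp: linear_functional_def)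
  ultimately have "d (\<Sum>s\<in>t. scale (r s) s) = r a"
    using assms(3,5) by simp
  moreover have "contract d (scale (r s) s) = (if s = a then scale (r a) a else 0)" if "s \<in> t" for s
  proof -
    have "s \<in> B" "grouplike s"
      using assms(2,4) that by auto
    then show ?thesis
      using d(2)[of s] d(3) by (simp add: contract_scale contract_grouplike d(1))
  qed
  then have "contract d (\<Sum>s\<in>t. scale (r s) s) = scale (r a) a"
    using assms(3,5) by (simp add: contract_sum[OF d(1)])
  ultimately show ?thesis
    using that d by blast
qed

text \<open>Expand a group-like \<gamma> outside a maximal independent set \<open>B\<close> of
  group-likes. Contraction with the functional dual to \<open>a\<close> gives \<open>r a\<close>
  times \<gamma>, because \<gamma> is group-like, and \<open>r a\<close> times \<open>a\<close> by
  linearity. As \<gamma> differs from \<open>a\<close>, every coefficient vanishes.\<close>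

lemma independent_grouplike: "independent {\<gamma>. grouplike \<gamma>}"
proof -
  obtain B where B: "B \<subseteq> {\<gamma>. grouplike \<gamma>}" "independent B" "{\<gamma>. grouplike \<gamma>} \<subseteq> span B"
    using maximal_independent_subset by blast
  have "\<gamma> \<in> B" if \<gamma>: "grouplike \<gamma>" for \<gamma>
  proof (rule ccontr)
    assume "\<gamma> \<notin> B"
    have "\<gamma> \<in> span B"
      using B \<gamma> by blast
    then obtain t r where t: "finite t" "t \<subseteq> B" "\<gamma> = (\<Sum>a\<in>t. scale (r a) a)"
      by (auto simp: span_explicit)
    have "r a = 0" if a: "a \<in> t" for a
    proof -
      obtain d where d: "linear_functional scale d" "d \<gamma> = r a" "contract d \<gamma> = scale (r a) a"
        using grouplike_coefficient[OF B(2,1) t(1,2) a, of r] t(3) by metis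
      then have "scale (r a) (\<gamma> - a) = 0"
        using contract_grouplike[OF d(1) \<gamma>] by (simp add: scale_right_diff_distrib)
      then show "r a = 0"
        using \<open>\<gamma> \<notin> B\<close> a t(2) by auto
    qed
    then have "\<gamma> = 0"
      unfolding t(3) by simp
    then show False
      using grouplike_nonzero \<gamma> by blast
  qed
  then have "B = {\<gamma>. grouplike \<gamma>}"
    using B(1) by blast
  with B(2) show ?thesis
    by simp
qed

lemma counit_skew_primitive:
  assumes "skew_primitive u h z" "grouplike u" "grouplike h"
  shows "counit z = 0"
proof -
  have "contract counit z = scale (counit u) z + scale (counit z) h"
    using assms(1) by (rule contract_skew_primitive[OF linear_functional_counit])
  then have "scale (counit z) h = 0"
    using assms(2) by (simp add: contract_counit grouplike_def)
  then show ?thesis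
    using grouplike_nonzero[OF assms(3)] by simp
qed

text \<open>Let \<open>d\<close> be dual to a group-like \<open>a\<close> other than
  \<open>u\<close> and \<open>h\<close>. Since \<open>d u = 0\<close>, the contraction of
  \<open>z\<close> equals both \<open>scale (d z) h\<close> and \<open>scale (r a) a\<close>;
  applying \<open>d\<close> once more yields \<open>r a = 0\<close>. Only \<open>h\<close> and
  \<open>u\<close> remain, and \<open>counit z = 0\<close> makes their coefficients
  opposite.\<close>

lemma skew_primitive_span_grouplike:
  assumes z: "skew_primitive u h z" and u: "grouplike u" and h: "grouplike h"
    and "z \<in> span {\<gamma>. grouplike \<gamma>}"
  obtains c where "z = scale c (h - u)"
proof -
  let ?G = "{\<gamma>. grouplike \<gamma>}"
  obtain t r where t: "finite t" "t \<subseteq> ?G" "z = (\<Sum>a\<in>t. scale (r a) a)"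
    using assms(4) by (auto simp: span_explicit)
  have "r a = 0" if a: "a \<in> t - {u, h}" for a
  proof -
    have "a \<in> t"
      using a by blast
    then obtain d where d: "linear_functional scale d" "\<And>s. s \<in> ?G - {a} \<Longrightarrow> d s = 0" "d a = 1"
      and "contract d z = scale (r a) a"
      using grouplike_coefficient[OF independent_grouplike subset_refl t(1,2), of a r] t(3) by metis
    moreover have "contract d z = scale (d z) h"
      using d(2)[of u] a u by (subst contract_skew_primitive[OF d(1) z]) auto
    ultimately have *: "scale (r a) a = scale (d z) h"
      by simp
    have "d (scale (r a) a) = d (scale (d z) h)"
      by (simp only: *)
    then show "r a = 0"
      using d(1,3) d(2)[of h] a h by (auto simp: linear_functional_def)
  qed
  then have "z = (\<Sum>a\<in>t \<inter> {u, h}. scale (r a) a)"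
    unfolding t(3) using t(1) by (intro sum.mono_neutral_right) auto
  then have "z \<in> span {u, h}"
    by (auto intro!: span_sum span_scale intro: span_base)
  then obtain a b where z_eq: "z = scale a h + scale b u"
    by (fastforce simp: span_insert algebra_simps)
  have "counit z = a + b"
    using u h by (simp add: z_eq counit_add counit_scale grouplike_def)
  then have "b = - a"
    using counit_skew_primitive[OF z u h] by (simp add: add_eq_0_iff)
  then have "z = scale a (h - u)"
    by (simp add: z_eq scale_right_diff_distrib)
  then show ?thesis
    by (rule that)
qed

end

lemma unit_inv_unique:
  fixes x :: "'a::monoid_mult"
  assumes "x * u = 1" "u * x = 1"
  shows "unit_inv x = u"
  unfolding unit_inv_def
proof (rule the_equality)
  fix v assume "x * v = 1 \<and> v * x = 1"
  then have "v = (u * x) * v" "u * (x * v) = u"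
    using assms by simp_all
  then show "v = u"
    by (simp add: mult.assoc)
qed (use assms in simp)

lemma commute_power_right:
  fixes x u :: "'a::monoid_mult"
  assumes "x * u = u * x"
  shows "x * u ^ n = u ^ n * x"
  by (induction n) (simp_all add: assms mult.assoc[symmetric], simp add: assms mult.assoc)

text \<open>Serves to cancel the factor \<open>g \<otimes> g\<close> on the left in
  \<open>grouplike_unit_inv\<close>.\<close>

lemma (in algebra_over) tensor2_mult_assoc_tens2:
  "tensor2_mult (tens2 a b) (tensor2_mult (tens2 c d) p)
     = tensor2_mult (tens2 (a * c) (b * d)) (p :: 'a \<times> 'a \<Rightarrow>\<^sub>0 'k)"
proof -
  have "lin_ext free_scale F (lin_ext free_scale G p) = lin_ext free_scale (\<lambda>x. lin_ext free_scale F (G x)) p"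
    for F G :: "'a \<times> 'a \<Rightarrow> ('a \<times> 'a \<Rightarrow>\<^sub>0 'k)"
    by (rule free.linear_comp_lin_ext)
      (auto simp: free.lin_ext_add free.lin_ext_scale free.vector_space_axioms)
  then show ?thesis
    by (simp add: tensor2_mult_def mult.assoc case_prod_unfold)
qed

lemma (in algebra_over) tensor2_mult_one [simp]:
  "tensor2_mult (tens2 1 1) p = (p :: 'a \<times> 'a \<Rightarrow>\<^sub>0 'k)"
proof (rule poly_mapping_eqI)
  fix x
  have "tensor2_mult (tens2 1 1) p = (\<Sum>z\<in>Poly_Mapping.keys p.
      free_scale (Poly_Mapping.lookup p z) (Poly_Mapping.single z 1))"
    by (simp add: tensor2_mult_def lin_ext_def[of _ _ p]) (simp add: tens2_def case_prod_unfold)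
  then show "Poly_Mapping.lookup (tensor2_mult (tens2 1 1) p) x = Poly_Mapping.lookup p x"
    by (simp add: lookup_sum lookup_single when_def if_distrib in_keys_iff cong: if_cong)
qed

section \<open>Group-likes and skew primitives in a Hopf algebra\<close>

context hopf_algebra
begin

lemma contract_mult:
  assumes "linear_functional scale d" "tensor2_eq scale (comult z) q"
  shows "contract d (x * z)
    = lin_ext scale (\<lambda>(a, b). lin_ext scale (\<lambda>(u, v). scale (d (b * v)) (a * u)) q) (comult x)"
proof -
  have "tensor2_eq scale (comult (x * z)) (tensor2_mult (comult x) q)"
    using comult_mult tensor2_mult_cong_right[OF assms(2)] by (rule tensor2_eq_trans)
  then show ?thesis
    by (simp add: contract_eq[OF assms(1)] lin_ext_tensor2_mult)
qed

lemma lin_ext_mult_right: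
  "lin_ext scale (\<lambda>(a, b). F a b * w) p = lin_ext scale (\<lambda>(a, b). F a b) p * w"
  by (simp add: lin_ext_def case_prod_unfold sum_distrib_right scale_mult_left)

lemma contract_mult_grouplike:
  assumes "linear_functional scale d" "grouplike \<gamma>"
  shows "contract d (x * \<gamma>) = contract (\<lambda>v. d (v * \<gamma>)) x * \<gamma>"
proof -
  have "tensor2_eq scale (comult \<gamma>) (tens2 \<gamma> \<gamma>)"
    using assms(2) by (simp add: grouplike_def)
  then show ?thesis
    by (simp add: contract_mult[OF assms(1)] contract_def[of _ x] scale_mult_left[symmetric]
        flip: lin_ext_mult_right)
qed

text \<open>In the product of the coproduct of \<open>x\<close> with
  \<open>y \<otimes> 1 + h \<otimes> y\<close>, either \<open>y\<close> stays in the first tensor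
  factor, or it is absorbed into the functional and leaves \<open>h\<close> behind. This change of
  functional is why the later inductions generalize over \<open>d\<close>.\<close>

lemma contract_mult_skew_primitive:
  assumes "linear_functional scale d" "skew_primitive 1 h y"
  shows "contract d (x * y) = contract d x * y + contract (\<lambda>v. d (v * y)) x * h"
proof -
  have "tensor2_eq scale (comult y) (tens2 y 1 + tens2 h y)"
    using assms(2) by (simp add: skew_primitive_def)
  then show ?thesis
    by (simp add: contract_mult[OF assms(1)] contract_def[of _ x] lin_ext_add scale_mult_left[symmetric]
        flip: lin_ext_fun_add lin_ext_mult_right)
qed

lemma linear_functional_mult_right:
  "linear_functional scale d \<Longrightarrow> linear_functional scale (\<lambda>v. d (v * w))"
  by (simp add: linear_functional_def distrib_right scale_mult_left)

lemma grouplike_one: "grouplike 1"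
  by (simp add: grouplike_def comult_one counit_one)

lemma grouplike_mult:
  assumes "grouplike g" "grouplike h"
  shows "grouplike (g * h)"
proof -
  note comult_mult[of g h]
  also have "tensor2_eq scale (tensor2_mult (comult g) (comult h)) (tensor2_mult (tens2 g g) (comult h))"
    using assms(1) by (intro tensor2_mult_cong_left) (simp add: grouplike_def)
  also have "tensor2_eq scale \<dots> (tensor2_mult (tens2 g g) (tens2 h h))"
    using assms(2) by (intro tensor2_mult_cong_right) (simp add: grouplike_def)
  finally show ?thesis
    using assms by (simp add: grouplike_def counit_mult)
qed

lemma grouplike_power: "grouplike g \<Longrightarrow> grouplike (g ^ n)"
  by (induction n) (simp_all add: grouplike_one grouplike_mult)

text \<open>On the representative \<open>g \<otimes> g\<close> of the coproduct, the antipode axioms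
  exhibit \<open>antipode g\<close> as a two-sided inverse of \<open>g\<close>.\<close>

lemma
  assumes "grouplike g"
  shows grouplike_unit_inv_right: "g * unit_inv g = 1"
    and grouplike_unit_inv_left: "unit_inv g * g = 1"
proof -
  have g: "tensor2_eq scale (comult g) (tens2 g g)" "counit g = 1"
    using assms by (simp_all add: grouplike_def)
  have "lin_ext scale (\<lambda>(u, v). antipode u * v) (comult g) = antipode g * g"
    by (subst lin_ext_tensor2_eq[OF g(1)])
      (simp_all add: antipode_add antipode_scale distrib_left distrib_right scale_mult_left scale_mult_right)
  then have l: "antipode g * g = 1"
    using g(2) by (simp add: antipode_left)
  have "lin_ext scale (\<lambda>(u, v). u * antipode v) (comult g) = g * antipode g"
    by (subst lin_ext_tensor2_eq[OF g(1)])
      (simp_all add: antipode_add antipode_scale distrib_left distrib_right scale_mult_left scale_mult_right)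
  then have r: "g * antipode g = 1"
    using g(2) by (simp add: antipode_right)
  have "unit_inv g = antipode g"
    using r l by (rule unit_inv_unique)
  with r l show "g * unit_inv g = 1" "unit_inv g * g = 1"
    by simp_all
qed

text \<open>Multiplying the coproduct of the inverse by \<open>g \<otimes> g\<close> gives the
  coproduct of 1, that is, \<open>1 \<otimes> 1\<close>; multiplying by the inverse of
  \<open>g \<otimes> g\<close> recovers the coproduct wanted.\<close>

lemma grouplike_unit_inv:
  assumes "grouplike g"
  shows "grouplike (unit_inv g)"
proof -
  let ?i = "unit_inv g"
  note inv = grouplike_unit_inv_right[OF assms] grouplike_unit_inv_left[OF assms]
  have g: "tensor2_eq scale (comult g) (tens2 g g)" "counit g = 1"
    using assms by (simp_all add: grouplike_def)
  have "tensor2_eq scale (tensor2_mult (tens2 g g) (comult ?i)) (tens2 1 1)"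
  proof -
    note tensor2_mult_cong_left[OF tensor2_eq_sym[OF g(1)]]
    also note tensor2_eq_sym[OF comult_mult]
    also have "tensor2_eq scale (comult (g * ?i)) (tens2 1 1)"
      by (simp add: inv comult_one)
    finally show ?thesis .
  qed
  from tensor2_mult_cong_right[OF this, of "tens2 ?i ?i"]
  have "tensor2_eq scale (comult ?i) (tens2 ?i ?i)"
    by (simp add: tensor2_mult_assoc_tens2 inv)
  moreover have "counit g * counit ?i = 1"
    by (simp flip: counit_mult add: inv counit_one)
  ultimately show ?thesis
    using g(2) by (simp add: grouplike_def)
qed

lemma grouplike_unit_power: "grouplike g \<Longrightarrow> grouplike (unit_power g b)"
  by (simp add: unit_power_def grouplike_power grouplike_unit_inv)

lemma grouplike_commute_unit_power:
  assumes "grouplike g"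
  shows "g * unit_power g b = unit_power g b * g"
  unfolding unit_power_def
  by (auto intro!: commute_power_right simp: grouplike_unit_inv_right grouplike_unit_inv_left assms)

text \<open>Conjugation of \<open>y \<otimes> 1 + h \<otimes> y\<close> by
  \<open>g \<otimes> g\<close> affects only \<open>y\<close>, since \<open>g\<close> commutes with 1
  and with \<open>h\<close>.\<close>

lemma skew_primitive_conj:
  assumes y: "skew_primitive 1 h y" and g: "grouplike g" and h: "g * h = h * g"
  shows "skew_primitive 1 h (g * y * unit_inv g)"
proof -
  let ?i = "unit_inv g"
  note inv = grouplike_unit_inv_right[OF g]
  note comult_mult[of "g * y" ?i]
  also note tensor2_mult_cong_left[OF comult_mult]
  also have "tensor2_eq scale (tensor2_mult (tensor2_mult (comult g) (comult y)) (comult ?i))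
      (tensor2_mult (tensor2_mult (tens2 g g) (comult y)) (comult ?i))"
    using g by (intro tensor2_mult_cong_left) (simp add: grouplike_def)
  also have "tensor2_eq scale \<dots>
      (tensor2_mult (tensor2_mult (tens2 g g) (tens2 y 1 + tens2 h y)) (comult ?i))"
    using y by (intro tensor2_mult_cong_left tensor2_mult_cong_right) (simp add: skew_primitive_def)
  also have "tensor2_eq scale \<dots>
      (tensor2_mult (tensor2_mult (tens2 g g) (tens2 y 1 + tens2 h y)) (tens2 ?i ?i))"
    using grouplike_unit_inv[OF g]
    by (intro tensor2_mult_cong_right) (simp add: grouplike_def)
  also have "tensor2_mult (tensor2_mult (tens2 g g) (tens2 y 1 + tens2 h y)) (tens2 ?i ?i :: 'a \<times> 'a \<Rightarrow>\<^sub>0 'k)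
      = tens2 (g * y * ?i) 1 + tens2 h (g * y * ?i)"
    by (simp add: tensor2_mult_add_left tensor2_mult_add_right inv h)
      (simp add: mult.assoc inv)
  finally show ?thesis
    by (simp add: skew_primitive_def)
qed

end

section \<open>Independence of increasing words\<close>

text \<open>The recursion is on the largest letter, which can only stand at the end; the induction
  in \<open>word_leading\<close> removes it there by one contraction.\<close>

primrec increasing_words :: "nat \<Rightarrow> nat list set" where
  "increasing_words 0 = {[]}"
| "increasing_words (Suc N) = increasing_words N \<union> (\<lambda>xs. xs @ [N]) ` increasing_words N"

lemma increasing_words_less: "xs \<in> increasing_words N \<Longrightarrow> i \<in> set xs \<Longrightarrow> i < N"
  by (induction N arbitrary: xs) (auto simp: less_Suc_eq)

lemma finite_increasing_words [simp]: "finite (increasing_words N)"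
  by (induction N) auto

lemma increasing_words_snoc_disjoint:
  "increasing_words N \<inter> (\<lambda>xs. xs @ [N]) ` increasing_words N = {}"
  using increasing_words_less by fastforce

lemma card_increasing_words: "card (increasing_words N) = 2 ^ N"
  by (induction N)
    (simp_all add: card_Un_disjoint increasing_words_snoc_disjoint card_image inj_on_def)

text \<open>The finite set \<open>F\<close> excludes an infinite basis of \<open>V\<close>, for
  which \<open>dim\<close> would take the value 0.\<close>

lemma (in vector_space) card_independent_le_dim:
  assumes "independent A" "A \<subseteq> V" "V \<subseteq> span F" "finite F"
  shows "card A \<le> dim V"
proof -
  obtain B where B: "A \<subseteq> B" "B \<subseteq> V" "independent B" "V \<subseteq> span B"
    using maximal_independent_subset_extend[OF assms(2,1)] by blast
  then have "finite B"
    using independent_span_bound[OF assms(4) B(3)] assms(3) by blast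
  with B show ?thesis
    using basis_card_eq_dim[OF B(2,4,3)] card_mono[of B A] by simp
qed

lemma (in algebra_over) span_mult:
  assumes "x \<in> span S" "z \<in> span T" "\<And>s t. s \<in> S \<Longrightarrow> t \<in> T \<Longrightarrow> s * t \<in> span U"
  shows "x * z \<in> span U"
proof -
  have "s * z \<in> span U" if "s \<in> S" for s
    using assms(2)
    by (induction rule: span_induct_alt)
      (auto simp: that distrib_left scale_mult_right span_zero intro!: span_add span_scale assms(3))
  with assms(1) show ?thesis
    by (induction rule: span_induct_alt)
      (auto simp: distrib_right scale_mult_left span_zero intro!: span_add span_scale)
qed

text \<open>Products of elements of \<open>span B\<close> expand multilinearly into words over
  \<open>B\<close> of the same length. For finite \<open>B\<close> this supplies the finite spanning
  set that \<open>card_independent_le_dim\<close> asks for.\<close>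

lemma (in algebra_over) power_sum_span_subset:
  "power_sum (span B) n \<subseteq> span {prod_list xs | xs. set xs \<subseteq> B \<and> length xs \<le> n}"
proof -
  have "prod_list xs \<in> span {prod_list ys | ys. set ys \<subseteq> B \<and> length ys = length xs}"
    if "set xs \<subseteq> span B" for xs
    using that
  proof (induction xs)
    case Nil
    then show ?case
      by (auto intro!: span_base)
  next
    case (Cons a xs)
    then have "a \<in> span B" "prod_list xs \<in> span {prod_list ys | ys. set ys \<subseteq> B \<and> length ys = length xs}"
      by auto
    then show ?case
      unfolding prod_list.Cons
    proof (rule span_mult)
      fix s t assume "s \<in> B" "t \<in> {prod_list ys | ys. set ys \<subseteq> B \<and> length ys = length xs}"
      then obtain ys where "t = prod_list ys" "set (s # ys) \<subseteq> B" "length (s # ys) = length (a # xs)"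
        by auto
      then show "s * t \<in> span {prod_list ys |ys. set ys \<subseteq> B \<and> length ys = length (a # xs)}"
        by (intro span_base CollectI exI[of _ "s # ys"]) auto
    qed
  qed
  then have "prod_list xs \<in> span {prod_list xs | xs. set xs \<subseteq> B \<and> length xs \<le> n}"
    if "set xs \<subseteq> span B" "length xs \<le> n" for xs
    using that span_mono[of "{prod_list ys | ys. set ys \<subseteq> B \<and> length ys = length xs}"
        "{prod_list xs | xs. set xs \<subseteq> B \<and> length xs \<le> n}"] by fastforce
  then show ?thesis
    unfolding power_sum_def by (intro span_minimal) auto
qed

lemma (in algebra_over) finite_bounded_products:
  assumes "finite B"
  shows "finite {prod_list xs | xs. set xs \<subseteq> B \<and> length xs \<le> n}"
proof -
  have "{prod_list xs | xs. set xs \<subseteq> B \<and> length xs \<le> n} = prod_list ` {xs. set xs \<subseteq> B \<and> length xs \<le> n}"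
    by auto
  then show ?thesis
    using finite_lists_length_le[OF assms] by simp
qed

section \<open>Words in skew primitives and the filtration by their length\<close>

definition word :: "(nat \<Rightarrow> 'a::monoid_mult) \<Rightarrow> nat list \<Rightarrow> 'a" where
  "word Y xs = prod_list (map Y xs)"

lemma word_Nil [simp]: "word Y [] = 1"
  and word_snoc [simp]: "word Y (xs @ [i]) = word Y xs * Y i"
  by (simp_all add: word_def)

context hopf_algebra
begin

text \<open>Stage \<open>Suc s\<close> is spanned by products of group-likes with at most
  \<open>s\<close> factors \<open>Y i\<close> among them. The shift by one makes stage 0 zero, so
  that lowering the length needs no truncated subtraction.\<close>

primrec skew_filtration :: "(nat \<Rightarrow> 'a) \<Rightarrow> nat \<Rightarrow> 'a set" where
  "skew_filtration Y 0 = {0}"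
| "skew_filtration Y (Suc s) =
     span ({\<gamma>. grouplike \<gamma>} \<union> {x * Y i * \<gamma> | x i \<gamma>. x \<in> skew_filtration Y s \<and> grouplike \<gamma>})"

context
  fixes Y :: "nat \<Rightarrow> 'a" and h :: 'a
  assumes Y: "\<And>i. skew_primitive 1 h (Y i)" and h: "grouplike h"
begin

abbreviation (input) W :: "nat \<Rightarrow> 'a set" where
  "W \<equiv> skew_filtration Y"

lemma subspace_skew_filtration: "subspace (W s)"
  by (cases s) auto

lemma skew_filtration_mult_generator: "x \<in> W s \<Longrightarrow> x * Y i \<in> W (Suc s)"
proof -
  assume "x \<in> W s"
  then have "\<exists>x' i' \<gamma>. x * Y i = x' * Y i' * \<gamma> \<and> x' \<in> W s \<and> grouplike \<gamma>"
    using grouplike_one by (intro exI[of _ x] exI[of _ i] exI[of _ 1]) simp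
  then show ?thesis
    by (auto intro: span_base)
qed

lemma skew_filtration_mult_grouplike:
  assumes "x \<in> W s" "grouplike \<gamma>"
  shows "x * \<gamma> \<in> W s"
proof (cases s)
  case 0
  with assms show ?thesis by simp
next
  case (Suc s')
  have "x * \<gamma> \<in> W (Suc s')"
    unfolding skew_filtration.simps
  proof (rule span_mult)
    show "x \<in> span ({\<gamma>. grouplike \<gamma>} \<union> {x * Y i * \<gamma> | x i \<gamma>. x \<in> W s' \<and> grouplike \<gamma>})"
      using assms(1) Suc by simp
    show "\<gamma> \<in> span {\<gamma>}"
      by (simp add: span_base)
    show "s * t \<in> span ({\<gamma>. grouplike \<gamma>} \<union> {x * Y i * \<gamma> | x i \<gamma>. x \<in> W s' \<and> grouplike \<gamma>})"
      if "s \<in> {\<gamma>. grouplike \<gamma>} \<union> {x * Y i * \<gamma> | x i \<gamma>. x \<in> W s' \<and> grouplike \<gamma>}" "t \<in> {\<gamma>}" for s t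
      using that assms(2) grouplike_mult by (intro span_base) (auto simp: mult.assoc, blast)
  qed
  then show ?thesis
    using Suc by simp
qed

lemma skew_filtration_Suc: "W s \<subseteq> W (Suc s)"
proof (induction s)
  case 0
  show ?case by (simp add: span_zero)
next
  case (Suc s)
  then show ?case
    unfolding skew_filtration.simps(2) by (intro span_mono) auto
qed

lemma skew_filtration_mono: "s \<le> t \<Longrightarrow> W s \<subseteq> W t"
  by (rule lift_Suc_mono_le[of W, OF skew_filtration_Suc])

lemma word_mem_skew_filtration: "word Y xs \<in> W (Suc (length xs))"
proof (induction xs rule: rev_induct)
  case Nil
  show ?case
    by (auto intro: span_base simp: grouplike_one)
next
  case (snoc i xs)
  then show ?case
    using skew_filtration_mult_generator[of "word Y xs" "Suc (length xs)"]
    by (simp del: skew_filtration.simps)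
qed

text \<open>The induction step shared by \<open>contract_skew_filtration\<close> and
  \<open>contract_skew_filtration_lower\<close>. The term that keeps \<open>Y i\<close> regains one
  factor, so there the contraction of \<open>x\<close> must lie one stage lower; in the other term
  \<open>h\<close> has replaced \<open>Y i\<close>.\<close>

lemma contract_skew_filtration_generator:
  assumes d: "linear_functional scale d" and \<gamma>: "grouplike \<gamma>"
    and "contract (\<lambda>v. d (v * \<gamma>)) x \<in> W s" "contract (\<lambda>v. d (v * Y i * \<gamma>)) x \<in> W (Suc s)"
  shows "contract d (x * Y i * \<gamma>) \<in> W (Suc s)"
proof -
  have "contract d (x * Y i * \<gamma>)
      = (contract (\<lambda>v. d (v * \<gamma>)) x * Y i + contract (\<lambda>v. d (v * Y i * \<gamma>)) x * h) * \<gamma>"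
    using d \<gamma> by (simp add: contract_mult_grouplike contract_mult_skew_primitive[OF _ Y]
        linear_functional_mult_right)
  also have "\<dots> \<in> W (Suc s)"
    using assms by (intro skew_filtration_mult_grouplike subspace_add[OF subspace_skew_filtration]
        skew_filtration_mult_generator h)
  finally show ?thesis .
qed

lemma linear_functional_mult_right2:
  "linear_functional scale d \<Longrightarrow> linear_functional scale (\<lambda>v. d (v * w * w'))"
  by (simp add: linear_functional_mult_right linear_functional_mult_right[of "\<lambda>v. d (v * w')"])

lemma contract_skew_filtration:
  "linear_functional scale d \<Longrightarrow> x \<in> W s \<Longrightarrow> contract d x \<in> W s"
proof (induction s arbitrary: d x)
  case 0
  then show ?case by (simp add: contract_zero)
next
  case (Suc s)
  note d = Suc.prems(1)
  show ?case
    unfolding skew_filtration.simps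
  proof (rule contract_mem_span[OF d _ Suc.prems(2)[unfolded skew_filtration.simps]])
    fix z assume z: "z \<in> {\<gamma>. grouplike \<gamma>} \<union> {x * Y i * \<gamma> | x i \<gamma>. x \<in> W s \<and> grouplike \<gamma>}"
    have "contract d z \<in> W (Suc s)" if "grouplike z"
      using that by (simp add: contract_grouplike[OF d] span_base span_scale)
    moreover have "contract d (x * Y i * \<gamma>) \<in> W (Suc s)" if "x \<in> W s" "grouplike \<gamma>" for x i \<gamma>
      using d that skew_filtration_Suc
      by (intro contract_skew_filtration_generator Suc.IH subsetD[OF skew_filtration_Suc]
          linear_functional_mult_right linear_functional_mult_right2)
    ultimately show "contract d z
        \<in> span ({\<gamma>. grouplike \<gamma>} \<union> {x * Y i * \<gamma> | x i \<gamma>. x \<in> W s \<and> grouplike \<gamma>})"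
      using z by auto
  qed
qed

text \<open>On a generator \<open>x * Y i * \<gamma>\<close>, the functional
  \<open>\<lambda>v. d (v * \<gamma>)\<close> again kills the group-likes, so the induction
  hypothesis lowers the term that keeps \<open>Y i\<close>. The other functional need not kill them,
  but its term has already lost the factor \<open>Y i\<close>, so
  \<open>contract_skew_filtration\<close> suffices.\<close>

lemma contract_skew_filtration_lower:
  assumes "linear_functional scale d" "\<And>\<gamma>. grouplike \<gamma> \<Longrightarrow> d \<gamma> = 0" "x \<in> W (Suc s)"
  shows "contract d x \<in> W s"
  using assms
proof (induction s arbitrary: d x)
  case (0 d x)
  have "contract d x \<in> span {0}"
  proof (rule contract_mem_span[OF 0(1) _ 0(3)[unfolded skew_filtration.simps]])
    fix z assume "z \<in> {\<gamma>. grouplike \<gamma>} \<union> {x * Y i * \<gamma> | x i \<gamma>. x \<in> {0} \<and> grouplike \<gamma>}"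
    then show "contract d z \<in> span {0}"
      using 0(1,2) by (auto simp: contract_grouplike contract_zero)
  qed
  then show ?case by (simp add: span_insert_0)
next
  case (Suc s d x)
  note d = Suc.prems(1,2)
  have "contract d x \<in> span (W (Suc s))"
  proof (rule contract_mem_span[OF d(1) _ Suc.prems(3)[unfolded skew_filtration.simps(2)[of _ "Suc s"]]])
    fix z assume z: "z \<in> {\<gamma>. grouplike \<gamma>} \<union> {x * Y i * \<gamma> | x i \<gamma>. x \<in> W (Suc s) \<and> grouplike \<gamma>}"
    have "contract d z \<in> W (Suc s)" if "grouplike z"
      using that d by (simp add: contract_grouplike span_zero)
    moreover have "contract d (x * Y i * \<gamma>) \<in> W (Suc s)" if "x \<in> W (Suc s)" "grouplike \<gamma>" for x i \<gamma>
      using d that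
      by (intro contract_skew_filtration_generator Suc.IH contract_skew_filtration
          linear_functional_mult_right linear_functional_mult_right2) (auto intro: grouplike_mult)
    ultimately show "contract d z \<in> span (W (Suc s))"
      using z by (auto intro: span_base simp del: skew_filtration.simps)
  qed
  then show ?case
    using subspace_skew_filtration span_eq_iff by metis
qed

text \<open>No group-like factors occur between the letters, so the functional applied to a prefix
  is either \<open>d\<close> itself or one for which the stage need not drop. Hence vanishing at 1
  is enough, and the lemma applies to functionals such as \<open>\<lambda>v. d (v * Y i)\<close>
  with \<open>d (Y i) = 0\<close>.\<close>

lemma contract_word:
  assumes "linear_functional scale d" "d 1 = 0"
  shows "contract d (word Y xs) \<in> W (length xs)"
  using assms
proof (induction xs arbitrary: d rule: rev_induct)
  case Nil
  then show ?case
    by (simp add: contract_grouplike grouplike_one)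
next
  case (snoc i xs d)
  have "contract d (word Y (xs @ [i])) = contract d (word Y xs) * Y i + contract (\<lambda>v. d (v * Y i)) (word Y xs) * h"
    using contract_mult_skew_primitive[OF snoc.prems(1) Y] by simp
  also have "\<dots> \<in> W (Suc (length xs))"
    using snoc.prems
    by (intro subspace_add[OF subspace_skew_filtration] skew_filtration_mult_generator snoc.IH
        skew_filtration_mult_grouplike contract_skew_filtration linear_functional_mult_right
        word_mem_skew_filtration h)
  finally show ?case
    by (simp del: skew_filtration.simps)
qed

text \<open>The factor \<open>Y n\<close> avoids the truncated exponent \<open>length xs - 1\<close>.\<close>

lemma contract_word_zero:
  assumes "linear_functional scale d" "d 1 = 0" "\<And>i. i \<in> set xs \<Longrightarrow> d (Y i) = 0"
  shows "contract d (word Y xs) * Y n \<in> W (length xs)"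
  using assms
proof (induction xs arbitrary: n rule: rev_induct)
  case Nil
  then show ?case
    by (simp add: contract_grouplike grouplike_one)
next
  case (snoc i xs)
  have "contract d (word Y (xs @ [i])) = contract d (word Y xs) * Y i + contract (\<lambda>v. d (v * Y i)) (word Y xs) * h"
    using contract_mult_skew_primitive[OF snoc.prems(1) Y] by simp
  \<comment> \<open>The first term is the induction hypothesis with \<open>i\<close> for
    \<open>n\<close>. In the second, \<open>\<lambda>v. d (v * Y i)\<close> vanishes at 1 because
    \<open>d (Y i) = 0\<close>, so \<open>contract_word\<close> applies.\<close>
  also have "\<dots> \<in> W (length xs)"
    using snoc.prems
    by (intro subspace_add[OF subspace_skew_filtration] snoc.IH skew_filtration_mult_grouplike
        contract_word linear_functional_mult_right h) auto
  finally show ?case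
    using skew_filtration_mult_generator by simp
qed

lemma contract_word_snoc:
  assumes "linear_functional scale d" "d 1 = 0" "\<And>i. i \<in> set xs \<Longrightarrow> d (Y i) = 0"
  shows "contract d (word Y (xs @ [n])) - scale (d (Y n)) (word Y xs * h) \<in> W (length xs)"
proof -
  \<comment> \<open>The multiple of the counit makes \<open>e\<close> vanish at 1. Since contraction
    with the counit is the identity, the part split off contributes exactly the leading
    term.\<close>
  define e where "e v = d (v * Y n) - d (Y n) * counit v" for v
  have e: "linear_functional scale e" "e 1 = 0"
    using assms(1) by (auto simp: e_def linear_functional_def distrib_right scale_mult_left
        counit_add counit_scale counit_one algebra_simps)
  have "contract (\<lambda>v. d (v * Y n)) x = contract e x + scale (d (Y n)) x" for x
  proof -
    have "contract (\<lambda>v. d (v * Y n)) x = contract e x + contract (\<lambda>v. d (Y n) * counit v) x"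
      using contract_functional_add[of e "\<lambda>v. d (Y n) * counit v"] by (simp add: e_def)
    also have "contract (\<lambda>v. d (Y n) * counit v) x = scale (d (Y n)) (contract counit x)"
      by (simp add: contract_def flip: lin_ext_fun_scale)
    finally show ?thesis
      by (simp add: contract_counit)
  qed
  then have "contract d (word Y (xs @ [n])) - scale (d (Y n)) (word Y xs * h)
      = contract d (word Y xs) * Y n + contract e (word Y xs) * h"
    by (simp add: contract_mult_skew_primitive[OF assms(1) Y] distrib_right scale_mult_left)
  also have "\<dots> \<in> W (length xs)"
    by (intro subspace_add[OF subspace_skew_filtration] skew_filtration_mult_grouplike
        contract_word contract_word_zero assms e h)
  finally show ?thesis .
qed

text \<open>Induction on the number of letters. One contraction strips the final letter
  \<open>N\<close>, so the induction hypothesis first kills the coefficients of the words ending in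
  \<open>N\<close>, at length one less, and then those of the remaining words.\<close>

lemma word_leading:
  assumes indep: "\<And>n. Y n \<notin> span ({\<gamma>. grouplike \<gamma>} \<union> Y ` {..<n})"
    and "(\<Sum>xs | xs \<in> increasing_words N \<and> length xs = r. scale (c xs) (word Y xs)) \<in> W r"
    and "xs \<in> increasing_words N" "length xs = r"
  shows "c xs = 0"
  using assms(2-)
proof (induction N arbitrary: r c xs)
  case 0
  have "{xs. xs = [] \<and> length xs = r} = {[]}"
    using 0 by auto
  then show ?case
    using 0 by simp
next
  case (Suc N r c xs)
  define A where "A s = {xs \<in> increasing_words N. length xs = s}" for s
  have fin: "finite (A s)" for s
    by (simp add: A_def)
  have old: "c ys = 0" if "(\<Sum>xs\<in>A r. scale (c xs) (word Y xs)) \<in> W r" "ys \<in> A r" for ys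
    using Suc.IH that by (auto simp: A_def)
  show ?case
  proof (cases r)
    case 0
    then have "{xs \<in> increasing_words (Suc N). length xs = r} = A r"
      by (auto simp: A_def)
    then have "?thesis \<longleftrightarrow> c xs = 0" "xs \<in> A r" "(\<Sum>xs\<in>A r. scale (c xs) (word Y xs)) \<in> W r"
      using Suc.prems by (auto simp del: increasing_words.simps skew_filtration.simps)
    then show ?thesis
      using old by blast
  next
    case (Suc s)
    have split: "{xs \<in> increasing_words (Suc N). length xs = r} = A r \<union> (\<lambda>xs. xs @ [N]) ` A s"
      using Suc by (auto simp: A_def)
    have disj: "A r \<inter> (\<lambda>xs. xs @ [N]) ` A s = {}"
      using increasing_words_snoc_disjoint by (fastforce simp: A_def)
    have total: "(\<Sum>xs\<in>A r. scale (c xs) (word Y xs))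
        + (\<Sum>xs\<in>A s. scale (c (xs @ [N])) (word Y (xs @ [N]))) \<in> W r" (is "?S + ?T \<in> _")
      using Suc.prems(1) fin unfolding split
      by (simp add: sum.union_disjoint disj sum.reindex inj_on_def del: skew_filtration.simps)
    obtain d where d: "linear_functional scale d"
        "\<And>v. v \<in> {\<gamma>. grouplike \<gamma>} \<union> Y ` {..<N} \<Longrightarrow> d v = 0" "d (Y N) = 1"
      using separating_functional[OF indep[of N]] by metis
    have d1: "d 1 = 0"
      using d(2) grouplike_one by auto
    have letters: "d (Y i) = 0" if "xs \<in> A t" "i \<in> set xs" for xs i t
      using d(2) increasing_words_less[of xs N i] that by (auto simp: A_def)
    have "contract d (?S + ?T) \<in> W s"
      using total d unfolding Suc by (intro contract_skew_filtration_lower) auto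
    moreover have "contract d ?S \<in> W s"
    proof -
      \<comment> \<open>The last letter of \<open>xs\<close> is also killed by \<open>d\<close>, so
        the leading term in \<open>contract_word_snoc\<close> is zero.\<close>
      have "contract d (word Y xs) \<in> W s" if xs: "xs \<in> A r" for xs
      proof -
        obtain ys i where ys: "xs = ys @ [i]"
          using xs Suc by (cases xs rule: rev_cases) (auto simp: A_def)
        have "length ys = s"
          using xs Suc by (simp add: A_def ys)
        moreover have "d (Y j) = 0" if "j \<in> set xs" for j
          using letters[OF xs that] .
        ultimately show ?thesis
          using contract_word_snoc[OF d(1) d1, of ys i] by (simp add: ys)
      qed
      then show ?thesis
        by (simp add: contract_sum contract_scale d(1))
          (intro subspace_sum[OF subspace_skew_filtration] subspace_scale[OF subspace_skew_filtration])
    qed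
    moreover have "contract d ?T - (\<Sum>xs\<in>A s. scale (c (xs @ [N])) (word Y xs)) * h \<in> W s"
    proof -
      have "contract d ?T - (\<Sum>xs\<in>A s. scale (c (xs @ [N])) (word Y xs)) * h
          = (\<Sum>xs\<in>A s. scale (c (xs @ [N])) (contract d (word Y (xs @ [N])) - word Y xs * h))"
        by (simp add: contract_sum contract_scale d(1) sum_distrib_right scale_mult_left
            sum_subtractf scale_right_diff_distrib)
      also have "\<dots> \<in> W s"
      proof (intro subspace_sum[OF subspace_skew_filtration] subspace_scale[OF subspace_skew_filtration])
        fix xs assume xs: "xs \<in> A s"
        then show "contract d (word Y (xs @ [N])) - word Y xs * h \<in> W s"
          using contract_word_snoc[OF d(1) d1, of xs N] letters[OF xs] d(3) by (simp add: A_def)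
      qed
      finally show ?thesis .
    qed
    ultimately have "contract d (?S + ?T) - contract d ?S
        - (contract d ?T - (\<Sum>xs\<in>A s. scale (c (xs @ [N])) (word Y xs)) * h) \<in> W s"
      using subspace_diff[OF subspace_skew_filtration] by blast
    then have "(\<Sum>xs\<in>A s. scale (c (xs @ [N])) (word Y xs)) * h \<in> W s"
      by (simp add: contract_add[OF d(1)])
    \<comment> \<open>The stages are stable under right multiplication by group-likes, so
      \<open>h\<close> can be cancelled without leaving \<open>W s\<close>.\<close>
    then have "(\<Sum>xs\<in>A s. scale (c (xs @ [N])) (word Y xs)) * h * unit_inv h \<in> W s"
      by (rule skew_filtration_mult_grouplike[OF _ grouplike_unit_inv[OF h]])
    then have "(\<Sum>xs\<in>A s. scale (c (xs @ [N])) (word Y xs)) \<in> W s"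
      by (simp add: mult.assoc grouplike_unit_inv_right[OF h])
    then have new: "c (ys @ [N]) = 0" if "ys \<in> A s" for ys
      using Suc.IH[of "\<lambda>xs. c (xs @ [N])" s ys] that by (simp add: A_def)
    then have "?S \<in> W r"
      using total by simp
    then show ?thesis
      using old new Suc.prems(2,3) Suc by (auto simp: A_def)
  qed
qed

text \<open>Let \<open>r\<close> be the greatest length of a word with nonzero coefficient. The
  shorter words lie in \<open>W r\<close>, hence so does the part of length \<open>r\<close>, and
  \<open>word_leading\<close> makes its coefficients vanish.\<close>

lemma word_independent_sum:
  assumes indep: "\<And>n. Y n \<notin> span ({\<gamma>. grouplike \<gamma>} \<union> Y ` {..<n})"
    and sum: "(\<Sum>xs\<in>increasing_words N. scale (c xs) (word Y xs)) = 0"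
    and "xs \<in> increasing_words N"
  shows "c xs = 0"
proof (rule ccontr)
  assume "c xs \<noteq> 0"
  let ?L = "length ` {xs \<in> increasing_words N. c xs \<noteq> 0}"
  define r where "r = Max ?L"
  have L: "finite ?L" "?L \<noteq> {}"
    using \<open>c xs \<noteq> 0\<close> assms(3) by auto
  have "r \<in> ?L"
    unfolding r_def using L by (rule Max_in)
  then obtain zs where zs: "zs \<in> increasing_words N" "c zs \<noteq> 0" "length zs = r"
    by auto
  have le: "length xs \<le> r" if "xs \<in> increasing_words N" "c xs \<noteq> 0" for xs
    unfolding r_def using L(1) that by (intro Max_ge) auto
  let ?A = "{xs. xs \<in> increasing_words N \<and> length xs = r}"
  have "(\<Sum>xs\<in>?A. scale (c xs) (word Y xs))
      = (\<Sum>xs\<in>increasing_words N. scale (c xs) (word Y xs))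
        - (\<Sum>xs\<in>increasing_words N - ?A. scale (c xs) (word Y xs))"
    using sum.subset_diff[of ?A "increasing_words N" "\<lambda>xs. scale (c xs) (word Y xs)"] by simp
  also have "\<dots> \<in> W r"
    unfolding sum
  proof (intro subspace_diff[OF subspace_skew_filtration] subspace_sum[OF subspace_skew_filtration]
        subspace_0[OF subspace_skew_filtration])
    fix xs assume xs: "xs \<in> increasing_words N - ?A"
    show "scale (c xs) (word Y xs) \<in> W r"
    proof (cases "c xs = 0")
      case True
      then show ?thesis
        by (simp add: subspace_0[OF subspace_skew_filtration])
    next
      case False
      then have "Suc (length xs) \<le> r"
        using le[of xs] xs by fastforce
      then have "word Y xs \<in> W r"
        using word_mem_skew_filtration skew_filtration_mono by blast
      then show ?thesis
        by (rule subspace_scale[OF subspace_skew_filtration])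
    qed
  qed
  finally have "c zs = 0"
    by (rule word_leading[OF indep _ zs(1,3)])
  with zs(2) show False ..
qed

lemma
  assumes indep: "\<And>n. Y n \<notin> span ({\<gamma>. grouplike \<gamma>} \<union> Y ` {..<n})"
  shows inj_on_word: "inj_on (word Y) (increasing_words N)"
    and independent_word: "independent (word Y ` increasing_words N)"
proof -
  show inj: "inj_on (word Y) (increasing_words N)"
  proof (rule inj_onI, rule ccontr)
    fix xs ys assume xs: "xs \<in> increasing_words N" and ys: "ys \<in> increasing_words N"
      and eq: "word Y xs = word Y ys" and "xs \<noteq> ys"
    \<comment> \<open>A coincidence of two words is a linear relation with coefficients 1 and
      -1.\<close>
    let ?c = "\<lambda>zs. (if zs = xs then 1 else 0) - (if zs = ys then 1 else 0)"
    have "(\<Sum>zs\<in>increasing_words N. scale (?c zs) (word Y zs)) = 0"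
      using xs ys eq
      by (simp add: scale_left_diff_distrib sum_subtractf if_distrib[of "\<lambda>c. scale c _"] cong: if_cong)
    then show False
      using word_independent_sum[OF indep, of ?c N xs] xs \<open>xs \<noteq> ys\<close> by simp
  qed
  show "independent (word Y ` increasing_words N)"
  proof
    assume "dependent (word Y ` increasing_words N)"
    then obtain u xs where "xs \<in> increasing_words N" "u (word Y xs) \<noteq> 0"
      "(\<Sum>xs\<in>increasing_words N. scale (u (word Y xs)) (word Y xs)) = 0"
      by (auto simp: dependent_finite sum.reindex[OF inj])
    then show False
      using word_independent_sum[OF indep, of "\<lambda>xs. u (word Y xs)" N xs] by simp
  qed
qed

end

end

section \<open>Growth and the conjugation operator\<close>

text \<open>At length \<open>n\<close> the dimension is at least \<open>2 ^ (n div 3)\<close>, and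
  the logarithm of this to base \<open>n\<close> is unbounded. The factor 3 is the length bound in
  \<open>word_conj_power_letters\<close>.\<close>

lemma (in algebra_over) GK_dim_eq_infinity:
  assumes "finite B" and growth: "\<And>N. 2 ^ N \<le> dim (power_sum (span B) (3 * N))"
  shows "GK_dim = \<infinity>"
proof -
  let ?D = "\<lambda>n. dim (power_sum (span B) n)"
  have mono: "?D m \<le> ?D n" if "m \<le> n" for m n
  proof -
    obtain A where A: "A \<subseteq> power_sum (span B) m" "independent A" "card A = ?D m"
      by (rule basis_exists)
    have "power_sum (span B) m \<subseteq> power_sum (span B) n"
      unfolding power_sum_def
    proof (rule span_mono, rule Collect_mono, rule impI)
      fix x assume "\<exists>xs. x = prod_list xs \<and> set xs \<subseteq> span B \<and> length xs \<le> m"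
      then show "\<exists>xs. x = prod_list xs \<and> set xs \<subseteq> span B \<and> length xs \<le> n"
        using that by (elim exE) (auto intro: le_trans)
    qed
    with A(1) have "A \<subseteq> power_sum (span B) n"
      by blast
    then have "card A \<le> ?D n"
      using A(2) by (intro card_independent_le_dim[OF _ _ power_sum_span_subset finite_bounded_products] assms(1))
    with A(3) show ?thesis
      by simp
  qed
  have "filterlim (\<lambda>n. (real n / 3 - 1) * ln 2 / ln (real n)) at_top sequentially"
    by real_asymp
  moreover have "\<forall>\<^sub>F n in sequentially.
      (real n / 3 - 1) * ln 2 / ln (real n) \<le> log (real n) (real (?D n))"
    \<comment> \<open>From \<open>n = 2\<close> on, the divisor \<open>ln (real n)\<close> is
      positive.\<close>
    using eventually_ge_at_top[of 2]
  proof eventually_elim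
    case (elim n)
    have "n < 3 * (n div 3) + 3"
      by presburger
    then have "real n < 3 * real (n div 3) + 3"
      by linarith
    then have "(real n / 3 - 1) * ln 2 \<le> real (n div 3) * ln 2"
      by (intro mult_right_mono) auto
    also have "\<dots> = ln (2 ^ (n div 3))"
      by (simp add: ln_realpow)
    also have "(2::real) ^ (n div 3) \<le> real (?D (3 * (n div 3)))"
      using of_nat_mono[OF growth[of "n div 3"], where 'a = real] by simp
    then have "(2::real) ^ (n div 3) \<le> real (?D n)"
      using mono[of "3 * (n div 3)" n] by simp
    then have "ln (2 ^ (n div 3)) \<le> ln (real (?D n))"
      by (intro ln_mono) simp_all
    finally show ?case
      using elim by (simp add: log_def divide_right_mono)
  qed
  ultimately have "filterlim (\<lambda>n. log (real n) (real (?D n))) at_top sequentially"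
    by (rule filterlim_at_top_mono)
  then have "((\<lambda>n. ereal (log (real n) (real (?D n)))) \<longlongrightarrow> \<infinity>) sequentially"
    by (simp add: tendsto_PInfty_eq_at_top)
  then have "limsup (\<lambda>n. ereal (log (real n) (real (?D n)))) = \<infinity>"
    by (intro lim_imp_Limsup) simp_all
  moreover have "limsup (\<lambda>n. ereal (log (real n) (real (?D n)))) \<le> GK_dim"
    unfolding GK_dim_def by (rule SUP_upper) (use assms(1) in blast)
  ultimately show ?thesis
    by simp
qed

section \<open>Conjugates of a skew primitive and exponential growth\<close>

context hopf_algebra
begin

lemma unit_inv_power:
  assumes "grouplike g"
  shows "g ^ n * unit_inv g ^ n = 1" "unit_inv g ^ n * g ^ n = 1"
proof -
  note inv = grouplike_unit_inv_right[OF assms] grouplike_unit_inv_left[OF assms]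
  show "g ^ n * unit_inv g ^ n = 1"
  proof (induction n)
    case (Suc n)
    have "g ^ Suc n * unit_inv g ^ Suc n = g * (g ^ n * unit_inv g ^ n) * unit_inv g"
      unfolding power_Suc[of g] power_Suc2[of "unit_inv g"] by (simp only: mult.assoc)
    also have "\<dots> = 1"
      by (simp add: Suc inv)
    finally show ?case .
  qed simp
  show "unit_inv g ^ n * g ^ n = 1"
  proof (induction n)
    case (Suc n)
    have "unit_inv g ^ Suc n * g ^ Suc n = unit_inv g * (unit_inv g ^ n * g ^ n) * g"
      unfolding power_Suc[of "unit_inv g"] power_Suc2[of g] by (simp only: mult.assoc)
    also have "\<dots> = 1"
      by (simp add: Suc inv)
    finally show ?case .
  qed simp
qed

definition conj_power :: "'a \<Rightarrow> 'a \<Rightarrow> nat \<Rightarrow> 'a" where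
  "conj_power g y i = g ^ i * y * unit_inv g ^ i"

lemma conj_power_0 [simp]: "conj_power g y 0 = y"
  by (simp add: conj_power_def)

lemma conj_power_Suc: "conj_power g y (Suc i) = g * conj_power g y i * unit_inv g"
  unfolding conj_power_def power_Suc[of g] power_Suc2[of "unit_inv g"] by (simp only: mult.assoc)

lemma conj_power_skew_primitive:
  assumes "skew_primitive 1 h y" "grouplike g" "g * h = h * g"
  shows "skew_primitive 1 h (conj_power g y i)"
  by (induction i) (simp_all add: assms conj_power_Suc skew_primitive_conj)

text \<open>Adjacent powers of \<open>g\<close> and its inverse cancel, so the total length is
  linear in \<open>N\<close>, whereas spelling out each conjugate separately gives a quadratic
  length.\<close>

lemma word_conj_power_letters:
  assumes g: "grouplike g" and "xs \<in> increasing_words N"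
  obtains zs where "set zs \<subseteq> {g, unit_inv g, y}" "length zs \<le> 3 * N"
    "prod_list zs = word (conj_power g y) xs"
proof -
  \<comment> \<open>The trailing \<open>g ^ N\<close> is exactly the left half of the next
    conjugate. Each step therefore appends \<open>g\<close> if the letter \<open>N\<close> is
    absent, and \<open>y\<close>, \<open>g\<close> if it is present.\<close>
  have "\<exists>zs. set zs \<subseteq> {g, unit_inv g, y} \<and> length zs \<le> 2 * N \<and>
      prod_list zs = word (conj_power g y) xs * g ^ N"
    using assms(2)
  proof (induction N arbitrary: xs)
    case 0
    then show ?case
      by (auto intro!: exI[of _ "[]"])
  next
    case (Suc N)
    consider "xs \<in> increasing_words N"
      | ys where "ys \<in> increasing_words N" "xs = ys @ [N]"
      using Suc.prems by auto
    then show ?case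
    proof cases
      case 1
      then obtain zs where "set zs \<subseteq> {g, unit_inv g, y}" "length zs \<le> 2 * N"
        "prod_list zs = word (conj_power g y) xs * g ^ N"
        using Suc.IH by blast
      then show ?thesis
        by (intro exI[of _ "zs @ [g]"]) (simp add: mult.assoc power_commutes)
    next
      case 2
      then obtain zs where zs: "set zs \<subseteq> {g, unit_inv g, y}" "length zs \<le> 2 * N"
        "prod_list zs = word (conj_power g y) ys * g ^ N"
        using Suc.IH by blast
      have "word (conj_power g y) xs * g ^ Suc N
          = word (conj_power g y) ys * g ^ N * y * (unit_inv g ^ N * g ^ N) * g"
        by (simp only: 2(2) word_snoc conj_power_def power_Suc2 mult.assoc)
      then have "word (conj_power g y) xs * g ^ Suc N = prod_list (zs @ [y, g])"
        by (simp add: zs(3) unit_inv_power[OF g] mult.assoc)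
      with zs(1,2) show ?thesis
        by (intro exI[of _ "zs @ [y, g]"]) simp
    qed
  qed
  then obtain zs where zs: "set zs \<subseteq> {g, unit_inv g, y}" "length zs \<le> 2 * N"
    "prod_list zs = word (conj_power g y) xs * g ^ N"
    by blast
  \<comment> \<open>Another \<open>N\<close> letters \<open>unit_inv g\<close> remove the trailing
    \<open>g ^ N\<close>, which raises the length bound from \<open>2 * N\<close> to
    \<open>3 * N\<close>.\<close>
  show ?thesis
  proof (rule that)
    show "set (zs @ replicate N (unit_inv g)) \<subseteq> {g, unit_inv g, y}"
      using zs(1) set_replicate_conv_if[of N "unit_inv g"] by auto
    show "length (zs @ replicate N (unit_inv g)) \<le> 3 * N"
      using zs(2) by simp
    show "prod_list (zs @ replicate N (unit_inv g)) = word (conj_power g y) xs"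
      by (simp add: zs(3) prod_list_replicate mult.assoc unit_inv_power[OF g])
  qed
qed

lemma conj_power_dependent:
  assumes "GK_dim < \<infinity>" and g: "grouplike g" and h: "grouplike h" "g * h = h * g"
    and y: "skew_primitive 1 h y"
  obtains n where "conj_power g y n \<in> span ({\<gamma>. grouplike \<gamma>} \<union> conj_power g y ` {..<n})"
proof (rule ccontr)
  note [simp del] = increasing_words.simps
  assume "\<not> thesis"
  then have indep: "conj_power g y n \<notin> span ({\<gamma>. grouplike \<gamma>} \<union> conj_power g y ` {..<n})" for n
    using that by blast
  let ?B = "{g, unit_inv g, y}"
  have "2 ^ N \<le> dim (power_sum (span ?B) (3 * N))" for N
  proof -
    note Y = conj_power_skew_primitive[OF y g h(2)]
    have "word (conj_power g y) xs \<in> power_sum (span ?B) (3 * N)"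
      if xs: "xs \<in> increasing_words N" for xs
    proof -
      obtain zs where zs: "set zs \<subseteq> ?B" "length zs \<le> 3 * N" "prod_list zs = word (conj_power g y) xs"
        using g xs by (rule word_conj_power_letters)
      have "set zs \<subseteq> span ?B"
        using zs(1) span_superset by (rule order_trans)
      with zs(2,3) show ?thesis
        unfolding power_sum_def by (intro span_base CollectI exI[of _ zs]) simp
    qed
    then have "card (word (conj_power g y) ` increasing_words N) \<le> dim (power_sum (span ?B) (3 * N))"
      by (intro card_independent_le_dim[OF independent_word[OF Y h(1) indep] _ power_sum_span_subset
            finite_bounded_products]) auto
    then show ?thesis
      by (simp add: card_image[OF inj_on_word[OF Y h(1) indep]] card_increasing_words)
  qed
  then have "GK_dim = \<infinity>"
    by (intro GK_dim_eq_infinity[of ?B]) auto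
  with assms(1) show False
    by simp
qed

section \<open>Polynomials in the conjugation operator\<close>

definition poly_conj :: "'a \<Rightarrow> 'a \<Rightarrow> 'k poly \<Rightarrow> 'a" where
  "poly_conj g y p = (\<Sum>i\<le>degree p. scale (coeff p i) (conj_power g y i))"

lemma poly_conj_altdef:
  assumes "degree p \<le> n"
  shows "poly_conj g y p = (\<Sum>i\<le>n. scale (coeff p i) (conj_power g y i))"
  unfolding poly_conj_def using assms
  by (intro sum.mono_neutral_left) (auto simp: coeff_eq_0)

text \<open>Multiplication of \<open>q\<close> by the variable shifts its coefficients, and
  conjugation by \<open>g\<close> shifts the conjugates in the same way.\<close>

lemma poly_conj_linear_factor:
  "poly_conj g y ([:- \<xi>, 1:] * q) = g * poly_conj g y q * unit_inv g - scale \<xi> (poly_conj g y q)"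
proof -
  let ?n = "Suc (degree q)"
  have "degree ([:- \<xi>, 1:] * q) \<le> ?n"
    using degree_mult_le[of "[:- \<xi>, 1:]" q] by simp
  moreover have "coeff ([:- \<xi>, 1:] * q) i = coeff (pCons 0 q) i - \<xi> * coeff q i" for i
    by simp
  ultimately have "poly_conj g y ([:- \<xi>, 1:] * q)
      = (\<Sum>i\<le>?n. scale (coeff (pCons 0 q) i) (conj_power g y i))
        - (\<Sum>i\<le>?n. scale (\<xi> * coeff q i) (conj_power g y i))"
    by (simp only: poly_conj_altdef[of _ ?n] scale_left_diff_distrib sum_subtractf)
  also have "(\<Sum>i\<le>?n. scale (coeff (pCons 0 q) i) (conj_power g y i)) = g * poly_conj g y q * unit_inv g"
    unfolding sum.atMost_Suc_shift poly_conj_def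
    by (simp add: conj_power_Suc sum_distrib_left sum_distrib_right scale_mult_left scale_mult_right)
  also have "(\<Sum>i\<le>?n. scale (\<xi> * coeff q i) (conj_power g y i)) = scale \<xi> (poly_conj g y q)"
    by (simp add: poly_conj_altdef[of q ?n] scale_sum_right del: sum.atMost_Suc)
  finally show ?thesis .
qed

text \<open>Used to go back from \<open>g * f * unit_inv g\<close> to \<open>f\<close> when the
  eigenvalue 0 is excluded.\<close>

lemma span_grouplike_conj:
  assumes "grouplike g" "x \<in> span {\<gamma>. grouplike \<gamma>}"
  shows "unit_inv g * x * g \<in> span {\<gamma>. grouplike \<gamma>}"
proof (rule span_mult)
  show "unit_inv g * x \<in> span {\<gamma>. grouplike \<gamma>}"
  proof (rule span_mult[OF _ assms(2)])
    show "unit_inv g \<in> span {unit_inv g}"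
      by (simp add: span_base)
  qed (simp add: span_base grouplike_mult grouplike_unit_inv assms(1))
  show "g \<in> span {g}"
    by (simp add: span_base)
qed (simp add: span_base grouplike_mult assms(1))

lemma poly_conj_skew_primitive:
  assumes "skew_primitive 1 h y" "grouplike g" "g * h = h * g"
  shows "skew_primitive 1 h (poly_conj g y p)"
proof -
  have "poly_conj g y p \<in> {z. skew_primitive 1 h z}"
    unfolding poly_conj_def
    by (intro subspace_sum[OF subspace_skew_primitive] subspace_scale[OF subspace_skew_primitive])
      (simp add: conj_power_skew_primitive[OF assms])
  then show ?thesis
    by simp
qed

lemma annihilating_poly:
  assumes "conj_power g y n \<in> span (S \<union> conj_power g y ` {..<n})"
  obtains p where "p \<noteq> 0" "poly_conj g y p \<in> span S"
proof -
  obtain z w where z: "z \<in> span S" and w: "w \<in> span (conj_power g y ` {..<n})"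
    and eq: "conj_power g y n = z + w"
    using assms unfolding span_Un mem_Collect_eq by (elim exE conjE)
  have "\<exists>a. w = (\<Sum>i<n. scale (a i) (conj_power g y i))"
    using w
  proof (induction rule: span_induct_alt)
    case base
    show ?case
      by (intro exI[of _ "\<lambda>_. 0"]) simp
  next
    case (step c x u)
    then obtain a j where "u = (\<Sum>i<n. scale (a i) (conj_power g y i))" "j < n" "x = conj_power g y j"
      by auto
    then show ?case
      by (intro exI[of _ "\<lambda>i. a i + (if i = j then c else 0)"])
        (simp add: scale_left_distrib sum.distrib if_distrib[of "\<lambda>c. scale c _"] cong: if_cong)
  qed
  then obtain a where a: "w = (\<Sum>i<n. scale (a i) (conj_power g y i))"
    by blast
  \<comment> \<open>The dependence relation read as a monic polynomial: its leading coefficient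
    makes it nonzero, and applied to \<open>y\<close> it leaves only the part \<open>z\<close> in
    \<open>span S\<close>.\<close>
  define p where "p = monom 1 n - (\<Sum>i<n. monom (a i) i)"
  have coeff: "coeff p i = (if i = n then 1 else if i < n then - a i else 0)" for i
    by (auto simp: p_def coeff_sum)
  then have "degree p \<le> n"
    by (intro degree_le) auto
  then have "poly_conj g y p = (\<Sum>i<Suc n. scale (coeff p i) (conj_power g y i))"
    by (simp add: poly_conj_altdef lessThan_Suc_atMost)
  also have "\<dots> = z"
    by (simp add: coeff eq a sum_negf)
  finally have "poly_conj g y p \<in> span S"
    using z by simp
  moreover have "p \<noteq> 0"
    using coeff[of n] by auto
  ultimately show ?thesis
    using that by blast
qed

end

text \<open>The eigenvector comes from a root of a polynomial of minimal degree that maps \<open>y\<close> into \<open>S\<close>.\<close>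

lemma (in hopf_algebra) eigenvector_modulo:
  fixes p :: "'k poly"
  assumes "\<And>q :: 'k poly. degree q > 0 \<Longrightarrow> \<exists>x. poly q x = 0"
    and "p \<noteq> 0" "poly_conj g y p \<in> span S" "y \<notin> span S"
  obtains q \<xi> where "poly_conj g y q \<notin> span S"
    "g * poly_conj g y q * unit_inv g - scale \<xi> (poly_conj g y q) \<in> span S"
proof -
  define P where "P p \<longleftrightarrow> p \<noteq> 0 \<and> poly_conj g y p \<in> span S" for p
  obtain p where p: "P p" and min: "\<And>q. P q \<Longrightarrow> degree p \<le> degree q"
    using ex_has_least_nat[of P p degree] assms(2,3) unfolding P_def by blast
  \<comment> \<open>A nonzero constant would put a nonzero multiple of \<open>y\<close>, hence
    \<open>y\<close> itself, into \<open>span S\<close>.\<close>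
  have "degree p > 0"
  proof (rule ccontr)
    assume "\<not> 0 < degree p"
    then have "coeff p 0 \<noteq> 0" "scale (coeff p 0) y \<in> span S"
      using p leading_coeff_neq_0[of p] by (auto simp: P_def poly_conj_def)
    then show False
      using assms(4) span_scale[of "scale (coeff p 0) y" S "inverse (coeff p 0)"] by simp
  qed
  then obtain \<xi> where "poly p \<xi> = 0"
    using assms(1) by blast
  then obtain q where q: "p = [:- \<xi>, 1:] * q"
    unfolding poly_eq_0_iff_dvd by (rule dvdE)
  then have "q \<noteq> 0"
    using p unfolding P_def by force
  then have "degree q < degree p"
    unfolding q by (subst degree_mult_eq) simp_all
  then have "poly_conj g y q \<notin> span S"
    using min[of q] \<open>q \<noteq> 0\<close> unfolding P_def by linarith
  moreover have "g * poly_conj g y q * unit_inv g - scale \<xi> (poly_conj g y q) \<in> span S"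
    using p unfolding P_def q poly_conj_linear_factor by (rule conjunct2)
  ultimately show ?thesis
    by (rule that)
qed

theorem theorem1p2:
  fixes scale :: "'k::{alg_closed_field, field_char_0} \<Rightarrow> 'a::ring_1 \<Rightarrow> 'a"
    and comult :: "'a \<Rightarrow> ('a \<times> 'a \<Rightarrow>\<^sub>0 'k)"
    and counit :: "'a \<Rightarrow> 'k"
    and antipode :: "'a \<Rightarrow> 'a"
    and K :: "nat \<Rightarrow> 'a set"
    and g y :: 'a
    and b :: int
  assumes "hopf_algebra scale comult counit antipode"
    and "coalgebra.pointed scale comult counit"
    and "algebra_over.GK_dim scale < \<infinity>"
    and "K = coalgebra.coradical_filtration scale comult"
    and "coalgebra.grouplike scale comult counit g"
    and "g \<noteq> 1"
    and "y \<in> K 1 - K 0"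
    and "coalgebra.skew_primitive scale comult 1 (unit_power g b) y"
  shows "\<exists>(m::nat) (c :: nat \<Rightarrow> 'k) (\<beta>::'k) (\<xi>::'k) f.
           \<xi> \<noteq> 0 \<and>
           f = (\<Sum>i\<le>m. scale (c i) (g ^ i * y * unit_inv g ^ i)) \<and>
           f \<in> K 1 - K 0 \<and>
           g * f = scale \<xi> (f * g) + scale \<beta> (g * (unit_power g b - 1))"
proof -
  interpret hopf_algebra scale comult counit antipode
    by fact
  let ?G = "{\<gamma>. grouplike \<gamma>}"
  define h where "h = unit_power g b"
  note g = assms(5) and y = assms(8)[folded h_def]
  have h: "grouplike h" "g * h = h * g"
    unfolding h_def using g by (rule grouplike_unit_power, rule grouplike_commute_unit_power)
  have K0: "K 0 = span ?G" and K1: "K 1 = coradical_filtration 1"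
    using assms(2,4) by (simp_all add: pointed_def)
  have y0: "y \<notin> span ?G"
    using assms(7) K0 by blast
  obtain n where "conj_power g y n \<in> span (?G \<union> conj_power g y ` {..<n})"
    using conj_power_dependent[OF assms(3) g h y] by metis
  then obtain p where p: "p \<noteq> 0" "poly_conj g y p \<in> span ?G"
    by (rule annihilating_poly)
  obtain q \<xi> where q: "poly_conj g y q \<notin> span ?G"
    and \<xi>: "g * poly_conj g y q * unit_inv g - scale \<xi> (poly_conj g y q) \<in> span ?G"
    using eigenvector_modulo[OF alg_closed_imp_poly_has_root p y0] by metis
  define f where "f = poly_conj g y q"
  note inv = grouplike_unit_inv_right[OF g] grouplike_unit_inv_left[OF g]
  have f: "skew_primitive 1 h f"
    unfolding f_def by (rule poly_conj_skew_primitive[OF y g h(2)])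
  have "f \<in> K 1"
    unfolding K1 using f by (rule skew_primitive_in_filtration_1)
      (use assms(4) K0 h(1) grouplike_one in \<open>auto intro: span_base\<close>)
  \<comment> \<open>For \<xi> = 0 the conjugate of \<open>f\<close> would lie in the span of the
    group-likes; conjugating back, so would \<open>f\<close>.\<close>
  have "\<xi> \<noteq> 0"
  proof
    assume "\<xi> = 0"
    then have "unit_inv g * (g * f * unit_inv g) * g \<in> span ?G"
      using \<xi> by (intro span_grouplike_conj g) (simp add: f_def)
    also have "unit_inv g * (g * f * unit_inv g) * g = (unit_inv g * g) * f * (unit_inv g * g)"
      by (simp only: mult.assoc)
    finally show False
      using q by (simp add: inv f_def)
  qed
  have "skew_primitive 1 h (g * f * unit_inv g - scale \<xi> f)"
    using subspace_diff[OF subspace_skew_primitive, of "g * f * unit_inv g" 1 h "scale \<xi> f"]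
      subspace_scale[OF subspace_skew_primitive, of f 1 h \<xi>] skew_primitive_conj[OF f g h(2)] f
    by simp
  \<comment> \<open>The eigenvector equation holds only modulo the coradical; its error term is skew
    primitive as well, which pins it down to a multiple of \<open>h - 1\<close>.\<close>
  then obtain \<beta> where \<beta>: "g * f * unit_inv g - scale \<xi> f = scale \<beta> (h - 1)"
    using \<xi> unfolding f_def[symmetric] by (rule skew_primitive_span_grouplike[OF _ grouplike_one h(1)])
  \<comment> \<open>Multiplying the previous equation by \<open>g\<close> on the right gives the
    claim, since \<open>h - 1\<close> commutes with \<open>g\<close>.\<close>
  have "g * f = g * f * unit_inv g * g"
    by (simp add: mult.assoc inv)
  also have "\<dots> = (scale \<xi> f + scale \<beta> (h - 1)) * g"
    using \<beta> by (simp only: diff_eq_eq add.commute)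
  also have "\<dots> = scale \<xi> (f * g) + scale \<beta> (g * (h - 1))"
    by (simp add: distrib_right scale_mult_left left_diff_distrib right_diff_distrib h(2))
  finally have "g * f = scale \<xi> (f * g) + scale \<beta> (g * (h - 1))" .
  moreover have "f = (\<Sum>i\<le>degree q. scale (coeff q i) (g ^ i * y * unit_inv g ^ i))"
    by (simp add: f_def poly_conj_def conj_power_def)
  moreover have "f \<in> K 1 - K 0"
    using \<open>f \<in> K 1\<close> q K0 by (simp add: f_def)
  ultimately show ?thesis
    using \<open>\<xi> \<noteq> 0\<close> unfolding h_def by blast
qed

end
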